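(* Let $\psi:[p_l,p_u]\to[0,\infty)$ be a probability density function satisfying $$\int_{p_l}^{p_u}p\,\psi(p)\,dp=\mu,\qquad \int_{p_l}^{p_u}p^2\psi(p)\,dp=\mu^2+\sigma^2,$$ and let $F$ be the corresponding distribution function. Then, for any control $u\in\mathcal{U}$ and any $\epsilon>0$, there exists $\delta>0$ such that the following inequalities hold for every partition $p_l=p_0<p_1<\dots<p_m=p_u$ with characteristic elements $p_d^i\in[p_{i-1},p_i)$ whose grid size $\Delta p=\max_i(p_i-p_{i-1})$ satisfies $\Delta p\le\delta$: (a) $\displaystyle\Big|\int p\,dF(p)-\sum_{i=1}^m p_d^i q_d^i\Big|=\Big|\int_{p_l}^{p_u}p\,\psi(p)\,dp-\sum_{i=1}^m p_d^i q_d^i\Big|\le\epsilon$; (b) $\displaystyle\Big|\int p^2\,dF(p)-\sum_{i=1}^m (p_d^i)^2 q_d^i\Big|=\Big|\int_{p_l}^{p_u}p^2\psi(p)\,dp-\sum_{i=1}^m (p_d^i)^2 q_d^i\Big|\le\epsilon$; (c) $\displaystyle\Big|\int h(x(t_f;u,p))\,dF(p)-\sum_{i=1}^m q_d^i\,h(x^i(t_f;u,p_d^i))\Big|\le\epsilon$, where $q_d^i=\int_{p_{i-1}}^{p_i}\psi(p)\,dp$ for $i=1,\dots,m$.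
   Context: Setting: $U\subset\mathbb{R}^{n_u}$ is compact and convex, $t_f>0$, $x^0\in\mathbb{R}^{n_x}$; $[p_l,p_u]\subset\mathbb{R}$ is the interval in which the uncertain parameter takes its values, and $\mu,\sigma$ are its given mean and standard deviation. $\mathcal{U}$ is the set of measurable functions $u:[0,t_f]\to U$. Standing assumptions: (A1) $f:\mathbb{R}^{n_x}\times U\times\mathbb{R}\to\mathbb{R}^{n_x}$ and $h:\mathbb{R}^{n_x}\to\mathbb{R}$ are at least continuously differentiable with respect to all their arguments; (A2) for each fixed $p\in\mathbb{R}$ there are positive constants $L,C$ with $\|f(x,u,p)\|\le L\|x\|+C$ for all $x\in\mathbb{R}^{n_x}$ and all control values $u\in U$. For $u\in\mathcal{U}$ and $p\in\mathbb{R}$, $x(\cdot;u,p)$ denotes the unique solution on $[0,t_f]$ of $\dot x(t)=f(x(t),u(t),p)$, $x(0)=x^0$, and $x^i(\cdot;u,p_d^i)$ denotes this solution with $p=p_d^i$. Integrals with respect to $dF$ are over $[p_l,p_u]$. *)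

theory Defs
  imports "HOL-Analysis.Analysis"
begin

(* S need not be open (in the application one factor is the control set, whose interior may be
   empty), so derivatives are taken within S.  They need not be unique then; some
   choice of them has to be continuous on S. *)
definition C1_on :: "('a::real_normed_vector \<Rightarrow> 'b::real_normed_vector) \<Rightarrow> 'a set \<Rightarrow> bool" where
  "C1_on g S \<longleftrightarrow>
     (\<exists>g' :: 'a \<Rightarrow> 'a \<Rightarrow>\<^sub>L 'b.
        (\<forall>z\<in>S. (g has_derivative blinfun_apply (g' z)) (at z within S)) \<and> continuous_on S g')"

(* The elements k of a division are non-overlapping compact intervals {Inf k..Sup k}. *)
definition abs_cont_on :: "(real \<Rightarrow> 'a::real_normed_vector) \<Rightarrow> real set \<Rightarrow> bool" where
  "abs_cont_on x S \<longleftrightarrow>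
     (\<forall>\<epsilon>>0. \<exists>\<delta>>0. \<forall>D T. D division_of T \<and> T \<subseteq> S \<and> (\<Sum>k\<in>D. Sup k - Inf k) < \<delta>
        \<longrightarrow> (\<Sum>k\<in>D. norm (x (Sup k) - x (Inf k))) < \<epsilon>)"

definition admissible_controls :: "real \<Rightarrow> (real^'k) set \<Rightarrow> (real \<Rightarrow> real^'k) set" where
  "admissible_controls tf U =
     {u. u \<in> borel_measurable (lebesgue_on {0..tf}) \<and> (\<forall>t\<in>{0..tf}. u t \<in> U)}"

(* Controls are merely measurable, so solutions are understood in the sense of Caratheodory. *)
definition is_solution ::
  "(real^'n \<Rightarrow> real^'k \<Rightarrow> real \<Rightarrow> real^'n) \<Rightarrow> real \<Rightarrow> real^'n \<Rightarrow> (real \<Rightarrow> real^'k) \<Rightarrow> real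
     \<Rightarrow> (real \<Rightarrow> real^'n) \<Rightarrow> bool" where
  "is_solution f tf x0 u p x \<longleftrightarrow>
     x 0 = x0 \<and> abs_cont_on x {0..tf} \<and>
     (AE t in lebesgue_on {0..tf}.
        (x has_vector_derivative f (x t) (u t) p) (at t within {0..tf}))"

(* The restriction to extensional functions fixes the irrelevant values outside {0..tf}, so that
   uniqueness on {0..tf} makes the description definite. *)
definition solution ::
  "(real^'n \<Rightarrow> real^'k \<Rightarrow> real \<Rightarrow> real^'n) \<Rightarrow> real \<Rightarrow> real^'n \<Rightarrow> (real \<Rightarrow> real^'k) \<Rightarrow> real
     \<Rightarrow> real \<Rightarrow> real^'n" where
  "solution f tf x0 u p = (THE x. x \<in> extensional {0..tf} \<and> is_solution f tf x0 u p x)"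

definition is_pdf_on :: "real \<Rightarrow> real \<Rightarrow> (real \<Rightarrow> real) \<Rightarrow> bool" where
  "is_pdf_on a b \<psi> \<longleftrightarrow>
     (\<forall>p\<in>{a..b}. 0 \<le> \<psi> p) \<and> set_integrable lebesgue {a..b} \<psi> \<and>
     (LINT p:{a..b}|lebesgue. \<psi> p) = 1"

(* Extended to the whole line (0 to the left of a, 1 to the right of b), so that
   interval_measure applies; that is the Lebesgue-Stieltjes measure dF. *)
definition distribution_function :: "real \<Rightarrow> real \<Rightarrow> (real \<Rightarrow> real) \<Rightarrow> real \<Rightarrow> real" where
  "distribution_function a b \<psi> p = (LINT s:{a..b} \<inter> {..p}|lebesgue. \<psi> s)"

definition is_partition :: "real \<Rightarrow> real \<Rightarrow> nat \<Rightarrow> (nat \<Rightarrow> real) \<Rightarrow> bool" where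
  "is_partition a b m P \<longleftrightarrow> 0 < m \<and> P 0 = a \<and> P m = b \<and> (\<forall>i\<in>{1..m}. P (i - 1) < P i)"

definition grid_size :: "nat \<Rightarrow> (nat \<Rightarrow> real) \<Rightarrow> real" where
  "grid_size m P = (MAX i\<in>{1..m}. P i - P (i - 1))"

definition cell_weight :: "(real \<Rightarrow> real) \<Rightarrow> (nat \<Rightarrow> real) \<Rightarrow> nat \<Rightarrow> real" where
  "cell_weight \<psi> P i = (LINT p:{P (i - 1)..P i}|lebesgue. \<psi> p)"

end

theory Submission
  imports Defs "HOL-Probability.Distribution_Functions"
begin

text \<open>
  The three inequalities are one fact applied to three integrands. If \<open>\<phi>\<close> is continuous on \<open>[a, b]\<close>,
  then \<open>\<phi>\<close> differs from \<open>\<phi> (d i)\<close> by at most \<open>\<epsilon>\<close> on the \<open>i\<close>-th cell of a fine enough partition, and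
  the cell weights are nonnegative with sum 1, so the weighted sum differs from the integral of
  \<open>\<phi> * \<psi>\<close> by at most \<open>\<epsilon>\<close> (\<open>weighted_Riemann_sum_approximation\<close>). The integrands are \<open>p\<close>, \<open>p\<^sup>2\<close> and
  \<open>h\<close> of the terminal state for the parameter \<open>p\<close>. Integrals against \<open>dF\<close> become integrals against
  \<open>\<psi>\<close> because \<open>dF\<close> is the measure with density \<open>\<psi>\<close> (\<open>integral_distribution_function\<close>).

  What needs work is that the terminal state depends continuously on \<open>p\<close>
  (\<open>solution_continuous_in_parameter\<close>). The growth constants may vary with \<open>p\<close> in an arbitrary way,
  so trajectories for different parameters have no common bound to start from. The remedy is to
  replace the state in the right-hand side by its projection to a ball. The cut-off right-hand
  side is Lipschitz in state and parameter together, as \<open>f\<close> is \<open>C\<^sup>1\<close> and the control set is compact and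
  convex; hence cut-off trajectories exist for every parameter by the contraction principle and are
  Lipschitz in the parameter by Gronwall. If the radius exceeds by 1 a bound for the trajectory of
  \<open>p\<close>, then for parameters near \<open>p\<close> the cut-off trajectory stays in the ball, so it solves the original
  equation and is the trajectory. The same cut-off gives existence: linear growth bounds all cut-off
  trajectories by a number that does not depend on the radius, and this number can be taken as radius.

  Since controls are only measurable, a solution is an absolutely continuous function satisfying
  the equation almost everywhere, while the arguments above concern the integral equation. The two
  are equivalent by the two halves of the fundamental theorem of calculus for the Lebesgue integral:
  an absolutely continuous function is the integral of its derivative
  (\<open>abs_cont_has_integral_derivative\<close>), and an indefinite integral is differentiable almost everywhere
  (\<open>negligible_non_differentiability_indefinite_integral\<close>). Both are obtained from gauges.
\<close>

section \<open>Absolute continuity and the fundamental theorem of calculus\<close>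

lemma sum_over_partial_tagged_division:
  fixes h :: "real set \<Rightarrow> 'a::comm_monoid_add"
  assumes p: "p tagged_partial_division_of S" and h: "\<And>u. h {u} = 0"
  shows "(\<Sum>(t, k)\<in>p. h k) = (\<Sum>k\<in>snd ` p. h k)"
proof -
  define h' where "h' k = (if k = {} then 0 else h k)" for k
  have "k \<noteq> {}" if "(t, k) \<in> p" for t k
    using tagged_partial_division_ofD(2)[OF p that] by auto
  then have eq: "(\<Sum>(t, k)\<in>p. h k) = (\<Sum>(t, k)\<in>p. h' k)" "(\<Sum>k\<in>snd ` p. h k) = (\<Sum>k\<in>snd ` p. h' k)"
    by (auto simp: h'_def intro!: sum.cong)
  have "h' {u..v} = 0" if "{u<..<v} = {}" for u v :: real
    using that h by (cases u v rule: linorder_cases) (auto simp: h'_def)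
  then show ?thesis
    unfolding eq using sum.over_tagged_division_lemma[OF tagged_partial_division_of_Union_self[OF p], of h']
    by (simp add: box_real)
qed

text \<open>
  The gauge treats the two kinds of tags differently. At a tag where \<open>x\<close> is differentiable, the cell is
  so short that the increment of \<open>x\<close> is close to length times derivative. The cells tagged in \<open>N\<close> are
  kept inside an open set of small measure containing \<open>N\<close>, so their total length is small and absolute
  continuity makes the sum of the increments of \<open>x\<close> over them small.
\<close>

theorem abs_cont_has_integral_derivative:
  fixes x :: "real \<Rightarrow> 'a::euclidean_space"
  assumes ab: "a \<le> b" and ac: "abs_cont_on x {a..b}" and N: "negligible N"
    and deriv: "\<And>t. t \<in> {a..b} - N \<Longrightarrow> (x has_vector_derivative g t) (at t within {a..b})"
  shows "(g has_integral x b - x a) {a..b}"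
proof -
  \<comment> \<open>With value 0 on \<open>N\<close>, a cell tagged in \<open>N\<close> contributes nothing to the Riemann sum.\<close>
  define g' where "g' t = (if t \<in> N then 0 else g t)" for t
  have "(g' has_integral x b - x a) {a..b}"
    unfolding has_integral_real
  proof (intro allI impI)
    fix e :: real assume e: "e > 0"
    \<comment> \<open>The differentiable tags may use up half of \<open>e\<close> over the whole interval; the \<open>+ 2\<close> covers \<open>a = b\<close>.\<close>
    define e' where "e' = e / (2 * (b - a) + 2)"
    have e': "e' > 0" "e' * (b - a) \<le> e / 2"
      using e ab by (auto simp: e'_def field_simps)
    obtain \<delta> where \<delta>: "\<delta> > 0" and small: "\<And>D T. D division_of T \<Longrightarrow> T \<subseteq> {a..b} \<Longrightarrow>
        (\<Sum>k\<in>D. Sup k - Inf k) < \<delta> \<Longrightarrow> (\<Sum>k\<in>D. norm (x (Sup k) - x (Inf k))) < e / 2"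
      using ac e unfolding abs_cont_on_def by (meson half_gt_zero)
    obtain G where G: "open G" "N \<subseteq> G" "G - N \<in> lmeasurable" "emeasure lebesgue (G - N) < ennreal \<delta>"
      using sets_lebesgue_outer_open[OF negligible_imp_sets[OF N] \<delta>] by metis
    have G_meas: "G \<in> lmeasurable" "measure lebesgue G < \<delta>"
    proof -
      have "negligible (sym_diff (G - N) G)"
        by (rule negligible_subset[OF N]) auto
      then show "G \<in> lmeasurable" 
        using G(3) lmeasurable_negligible_symdiff by blast
      have "measure lebesgue (G - N) = measure lebesgue G"
        using \<open>negligible (sym_diff (G - N) G)\<close> G(3) measure_negligible_symdiff by metis
      moreover have "measure lebesgue (G - N) < \<delta>"
        using G(3,4) \<delta> by (simp add: emeasure_eq_measure2 ennreal_less_iff)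
      ultimately show "measure lebesgue G < \<delta>" by simp
    qed
    have "\<forall>t. \<exists>d>0. t \<in> {a..b} - N \<longrightarrow>
         (\<forall>y\<in>{a..b}. norm (y - t) < d \<longrightarrow> norm (x y - x t - (y - t) *\<^sub>R g t) \<le> e' * norm (y - t))"
      using deriv[unfolded has_vector_derivative_def has_derivative_within_alt] e' by (metis zero_less_one)
    then obtain d where d: "\<And>t. d t > 0"
      "\<And>t y. \<lbrakk>t \<in> {a..b}; t \<notin> N; y \<in> {a..b}; norm (y - t) < d t\<rbrakk> \<Longrightarrow>
         norm (x y - x t - (y - t) *\<^sub>R g t) \<le> e' * norm (y - t)"
      by (metis DiffI)
    define \<gamma> where "\<gamma> t = (if t \<in> N then G else ball t (d t))" for t
    have gauge: "gauge \<gamma>"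
      using G(1,2) d(1) by (auto simp: gauge_def \<gamma>_def)
    have close: "norm ((\<Sum>(t, k)\<in>p. measure lborel k *\<^sub>R g' t) - (x b - x a)) < e"
      if p: "p tagged_division_of {a..b}" and fine: "\<gamma> fine p" for p
    proof -
      have fin: "finite p" using p by blast
      define q where "q = {(t, k)\<in>p. t \<in> N}"
      have q_sub: "q \<subseteq> p" by (auto simp: q_def)
      have q: "q tagged_partial_division_of {a..b}"
        using p q_sub tagged_partial_division_subset unfolding tagged_division_of_def by metis
      have cell: "\<exists>u v. k = {u..v} \<and> a \<le> u \<and> u \<le> t \<and> t \<le> v \<and> v \<le> b \<and> k \<subseteq> \<gamma> t" if tk: "(t, k) \<in> p" for t k
      proof -
        obtain u v where "k = {u..v}" "t \<in> k" "k \<subseteq> {a..b}"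
          using tagged_division_ofD(2)[OF p tk] tagged_division_ofD(3)[OF p tk]
            tagged_division_ofD(4)[OF p tk] by (metis box_real(2))
        moreover have "k \<subseteq> \<gamma> t" using fineD[OF fine tk] .
        ultimately show ?thesis by (intro exI[of _ u] exI[of _ v]) auto
      qed
      have bad: "(\<Sum>(t, k)\<in>q. norm (x (Sup k) - x (Inf k))) < e / 2"
      proof -
        have div: "snd ` q division_of \<Union>(snd ` q)"
          by (rule partial_division_of_tagged_division[OF q])
        have sub: "\<Union>(snd ` q) \<subseteq> G"
        proof
          fix s assume "s \<in> \<Union>(snd ` q)"
          then obtain t k where tk: "(t, k) \<in> q" "s \<in> k" by auto
          then have "k \<subseteq> \<gamma> t" "t \<in> N" using cell[of t k] q_sub by (auto simp: q_def)
          then show "s \<in> G" using tk by (auto simp: \<gamma>_def)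
        qed
        have ivl: "\<exists>u v. k = {u..v} \<and> u \<le> v \<and> a \<le> u \<and> v \<le> b" if kq: "k \<in> snd ` q" for k
        proof -
          obtain t where "(t, k) \<in> p" using kq q_sub by auto
          then show ?thesis using cell[of t k] by force
        qed
        have "(\<Sum>k\<in>snd ` q. Sup k - Inf k) = (\<Sum>k\<in>snd ` q. measure lebesgue k)"
        proof (rule sum.cong[OF refl])
          fix k assume "k \<in> snd ` q"
          then obtain u v where "k = {u..v}" "u \<le> v" using ivl by blast
          then show "Sup k - Inf k = measure lebesgue k" by simp
        qed
        also have "\<dots> = measure lebesgue (\<Union>(snd ` q))"
          using content_division[OF div] by simp
        also have "\<dots> \<le> measure lebesgue G"
          using div sub G_meas(1) by (intro measure_mono_fmeasurable) (auto simp: lmeasurable_division fmeasurableD)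
        finally have "(\<Sum>k\<in>snd ` q. Sup k - Inf k) < \<delta>"
          using G_meas by simp
        moreover have "\<Union>(snd ` q) \<subseteq> {a..b}"
          by (intro Union_least) (use ivl in force)
        ultimately have "(\<Sum>k\<in>snd ` q. norm (x (Sup k) - x (Inf k))) < e / 2"
          using small[OF div] by blast
        moreover have "(\<Sum>(t, k)\<in>q. norm (x (Sup k) - x (Inf k))) = (\<Sum>k\<in>snd ` q. norm (x (Sup k) - x (Inf k)))"
          by (rule sum_over_partial_tagged_division[OF q]) auto
        ultimately show ?thesis by simp
      qed
      have good: "norm (measure lborel k *\<^sub>R g' t - (x (Sup k) - x (Inf k))) \<le> e' * (Sup k - Inf k)"
        if tk: "(t, k) \<in> p - q" for t k
      proof -
        obtain u v where k: "k = {u..v}" "a \<le> u" "u \<le> t" "t \<le> v" "v \<le> b" "k \<subseteq> \<gamma> t"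
          using tk cell by blast
        have t: "t \<notin> N" using tk by (auto simp: q_def)
        have "u \<in> k" "v \<in> k" using k by auto
        then have uv: "u \<in> ball t (d t)" "v \<in> ball t (d t)"
          using k(6) t by (auto simp: \<gamma>_def)
        have "norm (x u - x t - (u - t) *\<^sub>R g t) \<le> e' * norm (u - t)"
          "norm (x v - x t - (v - t) *\<^sub>R g t) \<le> e' * norm (v - t)"
          using d(2)[of t u] d(2)[of t v] k t uv by (auto simp: dist_real_def abs_minus_commute)
        moreover have "measure lborel k *\<^sub>R g' t - (x (Sup k) - x (Inf k)) =
            (x u - x t - (u - t) *\<^sub>R g t) - (x v - x t - (v - t) *\<^sub>R g t)"
          using k t by (simp add: g'_def algebra_simps)
        ultimately have "norm (measure lborel k *\<^sub>R g' t - (x (Sup k) - x (Inf k))) \<le> e' * norm (u - t) + e' * norm (v - t)"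
          by (smt (verit) norm_triangle_ineq4)
        also have "\<dots> = e' * (Sup k - Inf k)" using k by (simp add: algebra_simps)
        finally show ?thesis .
      qed
      have "(\<Sum>(t, k)\<in>p. measure lborel k *\<^sub>R g' t) - (x b - x a) =
          (\<Sum>(t, k)\<in>p. measure lborel k *\<^sub>R g' t - (x (Sup k) - x (Inf k)))"
        unfolding additive_tagged_division_1[OF ab p, of x, symmetric] by (simp add: sum_subtractf case_prod_unfold)
      also have "\<dots> = (\<Sum>(t, k)\<in>p - q. measure lborel k *\<^sub>R g' t - (x (Sup k) - x (Inf k))) +
          (\<Sum>(t, k)\<in>q. measure lborel k *\<^sub>R g' t - (x (Sup k) - x (Inf k)))"
        by (rule sum.subset_diff[OF q_sub fin])
      also have "(\<Sum>(t, k)\<in>q. measure lborel k *\<^sub>R g' t - (x (Sup k) - x (Inf k))) = (\<Sum>(t, k)\<in>q. - (x (Sup k) - x (Inf k)))"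
        by (rule sum.cong) (auto simp: q_def g'_def)
      finally have split: "(\<Sum>(t, k)\<in>p. measure lborel k *\<^sub>R g' t) - (x b - x a) =
          (\<Sum>(t, k)\<in>p - q. measure lborel k *\<^sub>R g' t - (x (Sup k) - x (Inf k))) +
          (\<Sum>(t, k)\<in>q. - (x (Sup k) - x (Inf k)))" .
      have "norm ((\<Sum>(t, k)\<in>p. measure lborel k *\<^sub>R g' t) - (x b - x a)) \<le>
          norm (\<Sum>(t, k)\<in>p - q. measure lborel k *\<^sub>R g' t - (x (Sup k) - x (Inf k))) +
          norm (\<Sum>(t, k)\<in>q. - (x (Sup k) - x (Inf k)))"
        unfolding split by (rule norm_triangle_ineq)
      also have "norm (\<Sum>(t, k)\<in>q. - (x (Sup k) - x (Inf k))) \<le> (\<Sum>(t, k)\<in>q. norm (x (Sup k) - x (Inf k)))"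
        by (rule sum_norm_le) (auto simp: norm_minus_commute)
      also have "norm (\<Sum>(t, k)\<in>p - q. measure lborel k *\<^sub>R g' t - (x (Sup k) - x (Inf k))) \<le>
          (\<Sum>(t, k)\<in>p - q. e' * (Sup k - Inf k))"
        using good by (intro sum_norm_le) auto
      also have "\<dots> \<le> (\<Sum>(t, k)\<in>p. e' * (Sup k - Inf k))"
      proof (rule sum_mono2[OF fin])
        fix z assume z: "z \<in> p - (p - q)"
        obtain t k where tk: "z = (t, k)" by (cases z)
        then obtain u v where "k = {u..v}" "u \<le> t" "t \<le> v" using cell[of t k] z by blast
        then show "0 \<le> (case z of (t, k) \<Rightarrow> e' * (Sup k - Inf k))"
          using e' tk by simp
      qed auto
      also have "\<dots> = e' * (b - a)"
        using additive_tagged_division_1[OF ab p, of "\<lambda>y. y"] by (simp add: sum_distrib_left[symmetric] case_prod_unfold)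
      finally show ?thesis using bad e'(2) by simp
    qed
    show "\<exists>\<gamma>. gauge \<gamma> \<and> (\<forall>p. p tagged_division_of {a..b} \<and> \<gamma> fine p \<longrightarrow>
        norm ((\<Sum>(t, k)\<in>p. measure lborel k *\<^sub>R g' t) - (x b - x a)) < e)"
      by (intro exI[of _ \<gamma>] conjI allI impI gauge) (elim conjE, rule close)
  qed
  then show ?thesis
    by (rule has_integral_spike[OF N, rotated]) (auto simp: g'_def)
qed

text \<open>
  Let \<open>E \<eta>\<close> be the set of points \<open>t\<close> with arbitrarily short intervals ending at \<open>t\<close> over which the
  integral of \<open>g\<close> differs from length times \<open>g t\<close> by more than \<open>\<eta>\<close> times the length. These intervals form
  a Vitali cover of \<open>E \<eta>\<close>, even if only those inside a given gauge are kept, so countably many disjoint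
  ones cover \<open>E \<eta>\<close> up to a null set. Finitely many of them form a partial tagged division, and
  Henstock's lemma makes the sum of the deviations, which is at least \<open>\<eta>\<close> times the total length,
  arbitrarily small. Hence \<open>E \<eta>\<close> is negligible, and the
  derivative fails to be \<open>g t\<close> only on the union of the sets \<open>E (1 / Suc n)\<close>.
\<close>

theorem negligible_non_differentiability_indefinite_integral:
  fixes g :: "real \<Rightarrow> 'a::euclidean_space"
  assumes g: "g integrable_on {a..b}"
  shows "\<exists>N. negligible N \<and> (\<forall>t\<in>{a..b} - N.
           ((\<lambda>s. integral {a..s} g) has_vector_derivative g t) (at t within {a..b}))"
proof -
  define I where "I t = integral {a..t} g" for t
  define E where "E \<eta> = {t\<in>{a..b}. \<forall>d>0. \<exists>s\<in>{a..b}. \<bar>s - t\<bar> < d \<and>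
      norm (I s - I t - (s - t) *\<^sub>R g t) > \<eta> * \<bar>s - t\<bar>}" for \<eta> :: real
  \<comment> \<open>The segment between \<open>t\<close> and \<open>s\<close>, written as a ball because the Vitali covering theorem speaks of balls.\<close>
  define J where "J = (\<lambda>(t::real, s). cball ((t + s) / 2) (\<bar>s - t\<bar> / 2))"
  have J_eq: "J (t, s) = {min t s..max t s}" for t s
    by (auto simp: J_def cball_eq_atLeastAtMost min_def max_def field_simps)
  have increment: "norm (I s - I t - (s - t) *\<^sub>R g t) = norm (measure lborel (J (t, s)) *\<^sub>R g t - integral (J (t, s)) g)"
    if "t \<in> {a..b}" "s \<in> {a..b}" for s t
  proof -
    have comb: "I v - I u = integral {u..v} g" if "a \<le> u" "u \<le> v" "v \<le> b" for u v
    proof -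
      have "g integrable_on {a..v}"
        by (rule integrable_subinterval_real[OF g]) (use that in auto)
      from Henstock_Kurzweil_Integration.integral_combine[OF that(1,2) this] show ?thesis
        by (simp add: I_def algebra_simps)
    qed
    show ?thesis
    proof (cases "t \<le> s")
      case True
      then show ?thesis using comb[of t s] that by (simp add: J_eq norm_minus_commute)
    next
      case False
      then have "I s - I t - (s - t) *\<^sub>R g t = measure lborel (J (t, s)) *\<^sub>R g t - integral (J (t, s)) g"
        using comb[of s t] that by (simp add: J_eq algebra_simps)
      then show ?thesis by simp
    qed
  qed
  have "negligible (E \<eta>)" if \<eta>: "\<eta> > 0" for \<eta>
    unfolding negligible_outer_le
  proof (intro allI impI)
    fix e :: real assume e: "e > 0"
    obtain \<gamma> where \<gamma>: "gauge \<gamma>"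
      and henstock: "\<And>p. \<lbrakk>p tagged_partial_division_of {a..b}; \<gamma> fine p\<rbrakk> \<Longrightarrow>
             (\<Sum>(t, k)\<in>p. norm (measure lborel k *\<^sub>R g t - integral k g)) < e * \<eta>"
      using Henstock_lemma[of g a b "e * \<eta>"] g e \<eta> by (auto simp: box_real)
    define K where "K = {(t, s). t \<in> {a..b} \<and> s \<in> {a..b} \<and> t \<noteq> s \<and> J (t, s) \<subseteq> \<gamma> t \<and>
       norm (I s - I t - (s - t) *\<^sub>R g t) > \<eta> * \<bar>s - t\<bar>}"
    have fine_cover: "\<exists>i. i \<in> K \<and> t \<in> J i \<and> \<bar>snd i - fst i\<bar> / 2 < d"
      if t: "t \<in> E \<eta>" and d: "d > 0" for t d
    proof -
      obtain r where r: "r > 0" "ball t r \<subseteq> \<gamma> t"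
        using \<gamma> open_contains_ball unfolding gauge_def by blast
      obtain s where s: "s \<in> {a..b}" "\<bar>s - t\<bar> < min r d" "norm (I s - I t - (s - t) *\<^sub>R g t) > \<eta> * \<bar>s - t\<bar>"
      proof -
        have "\<forall>d>0. \<exists>s\<in>{a..b}. \<bar>s - t\<bar> < d \<and> norm (I s - I t - (s - t) *\<^sub>R g t) > \<eta> * \<bar>s - t\<bar>"
          using t by (simp add: E_def)
        from this[rule_format, of "min r d"] r d show ?thesis using that by auto
      qed
      have "J (t, s) \<subseteq> ball t r"
        using s by (auto simp: J_eq dist_real_def)
      moreover have "t \<noteq> s" using s(3) by auto
      ultimately have "(t, s) \<in> K"
        using s r t by (auto simp: K_def E_def)
      moreover have "t \<in> J (t, s)" by (simp add: J_eq)
      ultimately show ?thesis using s d by (intro exI[of _ "(t, s)"]) auto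
    qed
    have J_cball: "J i = cball ((fst i + snd i) / 2) (\<bar>snd i - fst i\<bar> / 2)" for i
      by (simp add: J_def case_prod_unfold)
    obtain C where C: "countable C" "C \<subseteq> K" "pairwise (\<lambda>i j. disjnt (J i) (J j)) C"
      "negligible (E \<eta> - (\<Union>i\<in>C. J i))"
    proof (rule Vitali_covering_theorem_cballs[of K "\<lambda>i. \<bar>snd i - fst i\<bar> / 2" "E \<eta>" "\<lambda>i. (fst i + snd i) / 2"])
      show "0 < \<bar>snd i - fst i\<bar> / 2" if "i \<in> K" for i
        using that by (auto simp: K_def)
      show "\<exists>i. i \<in> K \<and> x \<in> cball ((fst i + snd i) / 2) (\<bar>snd i - fst i\<bar> / 2) \<and> \<bar>snd i - fst i\<bar> / 2 < d"
        if "x \<in> E \<eta>" "0 < d" for x d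
        using fine_cover[OF that] by (simp add: J_cball)
    qed (use that in \<open>simp add: J_cball\<close>)
    have finite_bound: "(\<Sum>i\<in>F. measure lebesgue (J i)) \<le> e" if F: "F \<subseteq> C" "finite F" for F
    proof -
      have FK: "F \<subseteq> K" using F C by auto
      define p where "p = (\<lambda>i. (fst i, J i)) ` F"
      have disj: "J i \<inter> J j = {}" if "i \<in> F" "j \<in> F" "i \<noteq> j" for i j
        using C(3) F that unfolding pairwise_def disjnt_def by blast
      have nonempty: "J i \<noteq> {}" for i
        by (cases i) (simp add: J_eq)
      have inj: "inj_on (\<lambda>i. (fst i, J i)) F"
        by (rule inj_onI) (use disj nonempty in blast)
      have "p tagged_partial_division_of {a..b}"
        unfolding tagged_partial_division_of_def
      proof (intro conjI allI impI)
        show "finite p" using F by (simp add: p_def)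
        fix t k assume "(t, k) \<in> p"
        then obtain s where "(t, s) \<in> F" "k = J (t, s)" by (auto simp: p_def)
        then show "t \<in> k" "k \<subseteq> {a..b}" "\<exists>u v. k = cbox u v"
          using FK by (auto simp: K_def J_eq box_real)
      next
        fix t k t' k' assume *: "(t, k) \<in> p \<and> (t', k') \<in> p \<and> (t, k) \<noteq> (t', k')"
        then obtain i j where "i \<in> F" "j \<in> F" "k = J i" "k' = J j" "i \<noteq> j"
          by (auto simp: p_def)
        then have "k \<inter> k' = {}" using disj by blast
        then show "interior k \<inter> interior k' = {}"
          using interior_subset by blast
      qed
      moreover have "\<gamma> fine p"
      proof (rule fineI)
        fix t k assume "(t, k) \<in> p"
        then obtain s where "(t, s) \<in> F" "k = J (t, s)" by (auto simp: p_def)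
        then show "k \<subseteq> \<gamma> t" using FK by (auto simp: K_def)
      qed
      ultimately have "(\<Sum>(t, k)\<in>p. norm (measure lborel k *\<^sub>R g t - integral k g)) < e * \<eta>"
        by (rule henstock)
      also have "(\<Sum>(t, k)\<in>p. norm (measure lborel k *\<^sub>R g t - integral k g)) =
          (\<Sum>i\<in>F. norm (measure lborel (J i) *\<^sub>R g (fst i) - integral (J i) g))"
        unfolding p_def by (simp add: sum.reindex[OF inj])
      finally have total: "(\<Sum>i\<in>F. norm (measure lborel (J i) *\<^sub>R g (fst i) - integral (J i) g)) < e * \<eta>" .
      have "\<eta> * (\<Sum>i\<in>F. measure lebesgue (J i)) \<le>
          (\<Sum>i\<in>F. norm (measure lborel (J i) *\<^sub>R g (fst i) - integral (J i) g))"
        unfolding sum_distrib_left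
      proof (rule sum_mono)
        fix i assume i: "i \<in> F"
        obtain t s where ts: "i = (t, s)" by (cases i)
        have K: "t \<in> {a..b}" "s \<in> {a..b}" "\<eta> * \<bar>s - t\<bar> < norm (I s - I t - (s - t) *\<^sub>R g t)"
          using i FK ts by (auto simp: K_def)
        have "measure lebesgue (J i) = \<bar>s - t\<bar>" by (auto simp: ts J_eq min_def max_def)
        then show "\<eta> * measure lebesgue (J i) \<le> norm (measure lborel (J i) *\<^sub>R g (fst i) - integral (J i) g)"
          using K increment[OF K(1,2)] ts by simp
      qed
      with total have "\<eta> * (\<Sum>i\<in>F. measure lebesgue (J i)) < \<eta> * e" by (simp add: mult.commute)
      then show ?thesis using \<eta> by simp
    qed
    have J_meas: "J i \<in> lmeasurable" for i
      by (simp add: J_cball)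
    have union: "(\<Union>i\<in>C. J i) \<in> lmeasurable \<and> measure lebesgue (\<Union>i\<in>C. J i) \<le> e"
    proof -
      have bound: "measure lebesgue (\<Union>i\<in>F. J i) \<le> e" if "F \<subseteq> C" "finite F" for F
        using measure_UNION_le[of F J lebesgue] finite_bound[OF that] that J_meas
        by (meson fmeasurableD order_trans)
      show ?thesis
        using fmeasurable_UN_bound[OF C(1) J_meas bound] measure_UN_bound[OF C(1) J_meas bound] by blast
    qed
    define T where "T = (E \<eta> - (\<Union>i\<in>C. J i)) \<union> (\<Union>i\<in>C. J i)"
    have null: "E \<eta> - (\<Union>i\<in>C. J i) \<in> lmeasurable" "measure lebesgue (E \<eta> - (\<Union>i\<in>C. J i)) = 0"
      using C(4) by (simp_all add: negligible_iff_measure)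
    have "T \<in> lmeasurable"
      unfolding T_def by (rule fmeasurable.Un) (use null union in blast)+
    moreover have "measure lebesgue T \<le> e"
    proof -
      have "measure lebesgue T \<le> measure lebesgue (E \<eta> - (\<Union>i\<in>C. J i)) + measure lebesgue (\<Union>i\<in>C. J i)"
        unfolding T_def by (rule measure_Un_le) (use null union fmeasurableD in blast)+
      with null union show ?thesis by simp
    qed
    moreover have "E \<eta> \<subseteq> T" by (auto simp: T_def)
    ultimately show "\<exists>T. E \<eta> \<subseteq> T \<and> T \<in> lmeasurable \<and> measure lebesgue T \<le> e" by blast
  qed
  then have "negligible (\<Union>n. E (1 / Suc n))"
    by (intro negligible_countable_Union) auto
  moreover have "(I has_vector_derivative g t) (at t within {a..b})"
    if t: "t \<in> {a..b} - (\<Union>n. E (1 / Suc n))" for t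
    unfolding has_vector_derivative_def has_derivative_within_alt
  proof (intro conjI allI impI)
    show "bounded_linear (\<lambda>h. h *\<^sub>R g t)" by (rule bounded_linear_scaleR_left)
    fix e :: real assume "e > 0"
    then obtain n where n: "1 / Suc n < e" using nat_approx_posE by metis
    have "t \<notin> E (1 / Suc n)" using t by blast
    then have "\<not> (\<forall>d>0. \<exists>s\<in>{a..b}. \<bar>s - t\<bar> < d \<and>
        norm (I s - I t - (s - t) *\<^sub>R g t) > 1 / Suc n * \<bar>s - t\<bar>)"
      using t unfolding E_def by blast
    then obtain d where d: "d > 0" "\<And>s. s \<in> {a..b} \<Longrightarrow> \<bar>s - t\<bar> < d \<Longrightarrow>
        norm (I s - I t - (s - t) *\<^sub>R g t) \<le> 1 / Suc n * \<bar>s - t\<bar>"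
      unfolding not_all not_imp bex_simps not_less by (meson not_le)
    have "norm (I s - I t - (s - t) *\<^sub>R g t) \<le> e * norm (s - t)" if "s \<in> {a..b}" "norm (s - t) < d" for s
      using d(2)[of s] that n mult_right_mono[of "1 / Suc n" e "\<bar>s - t\<bar>"] by simp
    with d(1) show "\<exists>d>0. \<forall>s\<in>{a..b}. norm (s - t) < d \<longrightarrow> norm (I s - I t - (s - t) *\<^sub>R g t) \<le> e * norm (s - t)"
      by blast
  qed
  ultimately show ?thesis unfolding I_def by blast
qed

section \<open>Integral equations with a Lipschitz right-hand side\<close>

lemma has_integral_exp_kernel:
  fixes K t :: real
  assumes "0 < K" "0 \<le> t"
  shows "((\<lambda>s. K * exp (2 * K * s)) has_integral (exp (2 * K * t) - 1) / 2) {0..t}"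
proof -
  have "((\<lambda>s. exp (2 * K * s) / 2) has_vector_derivative K * exp (2 * K * s)) (at s within {0..t})" for s
    unfolding has_real_derivative_iff_has_vector_derivative[symmetric]
    by (auto intro!: derivative_eq_intros)
  from fundamental_theorem_of_calculus[OF assms(2) this] show ?thesis
    by (simp add: diff_divide_distrib)
qed


text \<open>
  The right-hand side \<open>B\<close> of the hypothesis has derivative \<open>K * \<phi> \<le> K * B\<close>, so \<open>exp (- K * t) * B t\<close> does
  not increase.
\<close>

lemma gronwall_integral:
  fixes \<phi> :: "real \<Rightarrow> real"
  assumes cont: "continuous_on {0..T} \<phi>" and K: "0 \<le> K"
    and bound: "\<And>t. t \<in> {0..T} \<Longrightarrow> \<phi> t \<le> c + K * integral {0..t} \<phi>"
    and t: "t \<in> {0..T}"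
  shows "\<phi> t \<le> c * exp (K * t)"
proof -
  define B where "B s = c + K * integral {0..s} \<phi>" for s
  define \<Phi> where "\<Phi> s = exp (- K * s) * B s" for s
  have "\<Phi> t \<le> \<Phi> 0"
  proof (rule DERIV_nonpos_imp_decreasing_open[of 0 t \<Phi>])
    show "0 \<le> t" using t by simp
    have "continuous_on {0..t} \<phi>"
      by (rule continuous_on_subset[OF cont]) (use t in auto)
    then show "continuous_on {0..t} \<Phi>"
      unfolding \<Phi>_def B_def
      by (intro continuous_intros indefinite_integral_continuous_1 integrable_continuous_real) auto
    fix s assume s: "0 < s" "s < t"
    have "((\<lambda>r. integral {0..r} \<phi>) has_real_derivative \<phi> s) (at s within {0..T})"
      by (rule integral_has_real_derivative[OF cont]) (use s t in auto)
    then have der: "((\<lambda>r. integral {0..r} \<phi>) has_real_derivative \<phi> s) (at s)"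
      using s t by (simp add: at_within_Icc_at)
    have "(\<Phi> has_real_derivative K * exp (- K * s) * (\<phi> s - B s)) (at s)"
      unfolding \<Phi>_def B_def by (auto intro!: derivative_eq_intros der simp: algebra_simps)
    moreover have "K * exp (- K * s) * (\<phi> s - B s) \<le> 0"
      using bound[of s] s t K by (intro mult_nonneg_nonpos) (auto simp: B_def)
    ultimately show "\<exists>y. (\<Phi> has_real_derivative y) (at s) \<and> y \<le> 0" by blast
  qed
  then have "B t \<le> c * exp (K * t)"
    by (simp add: \<Phi>_def B_def exp_minus field_simps)
  with bound[OF t] show ?thesis by (simp add: B_def)
qed

text \<open>
  The fixed point is sought for \<open>y t = exp (- 2 * K * t) * x t\<close>. With this weight the integral operator
  contracts the supremum norm by the factor 1/2 on the whole interval, whatever its length, because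
  \<open>exp (- 2 * K * t)\<close> times the integral of \<open>K * exp (2 * K * s)\<close> over \<open>[0, t]\<close> is less than 1/2. So no
  concatenation of short time steps is needed.
\<close>

lemma Picard_integral_equation:
  fixes G :: "real \<Rightarrow> 'a::euclidean_space \<Rightarrow> 'a"
  assumes T: "0 \<le> T" and K: "0 < K"
    and lip: "\<And>t x y. t \<in> {0..T} \<Longrightarrow> norm (G t x - G t y) \<le> K * norm (x - y)"
    and int: "\<And>x. continuous_on {0..T} x \<Longrightarrow> (\<lambda>t. G t (x t)) integrable_on {0..T}"
  shows "\<exists>x. continuous_on {0..T} x \<and> (\<forall>t\<in>{0..T}. x t = x0 + integral {0..t} (\<lambda>s. G s (x s)))"
proof -
  \<comment> \<open>Bounded continuous functions live on the whole line; \<open>\<tau>\<close> extends functions on \<open>[0, T]\<close> by constants.\<close>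
  define \<tau> where "\<tau> t = max 0 (min T t)" for t :: real
  have \<tau>: "\<tau> t \<in> {0..T}" "t \<in> {0..T} \<Longrightarrow> \<tau> t = t" for t
    using T by (auto simp: \<tau>_def)
  have \<tau>_cont: "continuous_on UNIV \<tau>" unfolding \<tau>_def by (intro continuous_intros)
  define A where "A y t = exp (- 2 * K * t) *\<^sub>R (x0 + integral {0..t} (\<lambda>s. G s (exp (2 * K * s) *\<^sub>R apply_bcontfun y s)))"
    for y :: "(real, 'a) bcontfun" and t
  have int_y: "(\<lambda>s. G s (exp (2 * K * s) *\<^sub>R apply_bcontfun y s)) integrable_on {0..t}" if "t \<in> {0..T}" for y t
    by (rule integrable_subinterval_real[OF int]) (use that in \<open>auto intro!: continuous_intros\<close>)
  have A_cont: "continuous_on {0..T} (A y)" for y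
    unfolding A_def using T int_y[of T y] by (intro continuous_intros indefinite_integral_continuous_1) auto
  have A_bcont: "(\<lambda>t. A y (\<tau> t)) \<in> bcontfun" for y
  proof -
    have "continuous_on UNIV (\<lambda>t. A y (\<tau> t))"
      by (rule continuous_on_compose2[OF A_cont \<tau>_cont]) (use \<tau> in auto)
    moreover have "range (\<lambda>t. A y (\<tau> t)) \<subseteq> A y ` {0..T}"
      using \<tau> by auto
    then have "bounded (range (\<lambda>t. A y (\<tau> t)))"
      using compact_imp_bounded[OF compact_continuous_image[OF A_cont compact_Icc]] bounded_subset by blast
    ultimately show ?thesis by (simp add: bcontfun_def)
  qed
  have apply_A: "apply_bcontfun (Bcontfun (\<lambda>t. A y (\<tau> t))) t = A y (\<tau> t)" for y t
    by (simp add: Bcontfun_inverse[OF A_bcont])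
  have contr: "dist (A y t) (A z t) \<le> 1 / 2 * dist y z" if t: "t \<in> {0..T}" for y z t
  proof -
    let ?g = "\<lambda>y s. G s (exp (2 * K * s) *\<^sub>R apply_bcontfun y s)"
    have "norm (integral {0..t} (?g y) - integral {0..t} (?g z)) = norm (integral {0..t} (\<lambda>s. ?g y s - ?g z s))"
      using int_y[OF t] by (simp add: integral_diff)
    also have "\<dots> \<le> integral {0..t} (\<lambda>s. K * exp (2 * K * s) * dist y z)"
    proof (rule integral_norm_bound_integral)
      show "(\<lambda>s. ?g y s - ?g z s) integrable_on {0..t}"
        using int_y[OF t] by (intro integrable_diff)
      show "(\<lambda>s. K * exp (2 * K * s) * dist y z) integrable_on {0..t}"
        by (intro integrable_continuous_real continuous_intros)
      fix s assume s: "s \<in> {0..t}"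
      have "norm (?g y s - ?g z s) \<le> K * norm (exp (2 * K * s) *\<^sub>R apply_bcontfun y s - exp (2 * K * s) *\<^sub>R apply_bcontfun z s)"
        using s t by (intro lip) auto
      also have "\<dots> = K * exp (2 * K * s) * dist (apply_bcontfun y s) (apply_bcontfun z s)"
        by (simp add: dist_norm scaleR_diff_right[symmetric])
      also have "\<dots> \<le> K * exp (2 * K * s) * dist y z"
        using K by (intro mult_left_mono dist_bounded) auto
      finally show "norm (?g y s - ?g z s) \<le> K * exp (2 * K * s) * dist y z" .
    qed
    also have "\<dots> = (exp (2 * K * t) - 1) / 2 * dist y z"
      using has_integral_mult_left[OF has_integral_exp_kernel[OF K, of t], of "dist y z"] t by (intro integral_unique) auto
    also have "\<dots> \<le> exp (2 * K * t) / 2 * dist y z"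
      by (intro mult_right_mono) auto
    finally have "exp (- 2 * K * t) * norm (integral {0..t} (?g y) - integral {0..t} (?g z)) \<le>
        exp (- 2 * K * t) * (exp (2 * K * t) / 2 * dist y z)"
      by (intro mult_left_mono) auto
    also have "\<dots> = 1 / 2 * dist y z"
      by (simp add: exp_minus)
    finally show ?thesis
      by (simp add: A_def dist_norm scaleR_diff_right[symmetric])
  qed
  have "dist (Bcontfun (\<lambda>t. A y (\<tau> t))) (Bcontfun (\<lambda>t. A z (\<tau> t))) \<le> 1 / 2 * dist y z" for y z
    by (rule dist_bound) (unfold apply_A, rule contr[OF \<tau>(1)])
  then have "\<exists>!y. Bcontfun (\<lambda>t. A y (\<tau> t)) = y"
    by (intro banach_fix_type[of "1 / 2"]) auto
  then obtain y where y: "Bcontfun (\<lambda>t. A y (\<tau> t)) = y" by blast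
  have fixed: "apply_bcontfun y t = A y t" if "t \<in> {0..T}" for t
    using apply_A[of y t] \<tau>(2)[OF that] y by simp
  define x where "x t = exp (2 * K * t) *\<^sub>R apply_bcontfun y t" for t
  have "continuous_on {0..T} x"
    unfolding x_def by (intro continuous_intros) auto
  moreover have "x t = x0 + integral {0..t} (\<lambda>s. G s (x s))" if "t \<in> {0..T}" for t
    unfolding x_def fixed[OF that] by (simp add: A_def exp_minus)
  ultimately show ?thesis by blast
qed

section \<open>Regularity and cut-off of the right-hand side\<close>

lemma lipschitz_imp_abs_cont_on:
  fixes x :: "real \<Rightarrow> 'a::real_normed_vector"
  assumes lip: "\<And>s t. s \<in> S \<Longrightarrow> t \<in> S \<Longrightarrow> norm (x t - x s) \<le> B * \<bar>t - s\<bar>" and B: "0 \<le> B"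
  shows "abs_cont_on x S"
  unfolding abs_cont_on_def
proof (intro allI impI)
  fix \<epsilon> :: real assume \<epsilon>: "\<epsilon> > 0"
  have "(\<Sum>k\<in>D. norm (x (Sup k) - x (Inf k))) < \<epsilon>"
    if D: "D division_of R" "R \<subseteq> S" "(\<Sum>k\<in>D. Sup k - Inf k) < \<epsilon> / (B + 1)" for D R
  proof -
    have cell: "norm (x (Sup k) - x (Inf k)) \<le> B * (Sup k - Inf k)" if k: "k \<in> D" for k
    proof -
      obtain c d where cd: "k = {c..d}" using division_ofD(4)[OF D(1) k] by (auto simp: box_real)
      moreover have "k \<noteq> {}" "k \<subseteq> S" using division_ofD(2,3)[OF D(1) k] D(2) by auto
      ultimately have "c \<le> d" "c \<in> S" "d \<in> S" by auto
      with lip[of c d] cd show ?thesis by simp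
    qed
    have "(\<Sum>k\<in>D. norm (x (Sup k) - x (Inf k))) \<le> B * (\<Sum>k\<in>D. Sup k - Inf k)"
      unfolding sum_distrib_left by (rule sum_mono) (rule cell)
    also have "\<dots> \<le> B * (\<epsilon> / (B + 1))"
      using D(3) B by (intro mult_left_mono) auto
    also have "\<dots> < \<epsilon>" using \<epsilon> B by (simp add: field_simps)
    finally show ?thesis .
  qed
  then show "\<exists>\<delta>>0. \<forall>D R. D division_of R \<and> R \<subseteq> S \<and> (\<Sum>k\<in>D. Sup k - Inf k) < \<delta> \<longrightarrow>
      (\<Sum>k\<in>D. norm (x (Sup k) - x (Inf k))) < \<epsilon>"
    using \<epsilon> B by (intro exI[of _ "\<epsilon> / (B + 1)"]) auto
qed

lemma abs_cont_on_imp_continuous_on: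
  fixes x :: "real \<Rightarrow> 'a::real_normed_vector"
  assumes ac: "abs_cont_on x {a..b}"
  shows "continuous_on {a..b} x"
  unfolding continuous_on_iff
proof (intro ballI allI impI)
  fix t \<epsilon> :: real assume t: "t \<in> {a..b}" and \<epsilon>: "0 < \<epsilon>"
  obtain \<delta> where \<delta>: "\<delta> > 0" and small: "\<And>D T. D division_of T \<Longrightarrow> T \<subseteq> {a..b} \<Longrightarrow>
      (\<Sum>k\<in>D. Sup k - Inf k) < \<delta> \<Longrightarrow> (\<Sum>k\<in>D. norm (x (Sup k) - x (Inf k))) < \<epsilon>"
    using ac \<epsilon> unfolding abs_cont_on_def by meson
  have "dist (x s) (x t) < \<epsilon>" if s: "s \<in> {a..b}" "dist s t < \<delta>" for s
  proof -
    have "{{min s t..max s t}} division_of {min s t..max s t}"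
      using division_of_self[of "min s t" "max s t"] by (simp add: box_real)
    from small[OF this] show ?thesis
      using s t by (cases "s \<le> t") (auto simp: dist_norm norm_minus_commute)
  qed
  with \<delta> show "\<exists>d>0. \<forall>s\<in>{a..b}. dist s t < d \<longrightarrow> dist (x s) (x t) < \<epsilon>" by blast
qed

lemma abs_cont_on_subset:
  assumes "abs_cont_on x S" "S' \<subseteq> S"
  shows "abs_cont_on x S'"
  unfolding abs_cont_on_def
proof (intro allI impI)
  fix \<epsilon> :: real assume "\<epsilon> > 0"
  then obtain \<delta> where \<delta>: "\<delta> > 0" and small: "\<And>D T. D division_of T \<Longrightarrow> T \<subseteq> S \<Longrightarrow>
      (\<Sum>k\<in>D. Sup k - Inf k) < \<delta> \<Longrightarrow> (\<Sum>k\<in>D. norm (x (Sup k) - x (Inf k))) < \<epsilon>"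
    using assms(1) unfolding abs_cont_on_def by meson
  show "\<exists>\<delta>>0. \<forall>D T. D division_of T \<and> T \<subseteq> S' \<and> (\<Sum>k\<in>D. Sup k - Inf k) < \<delta> \<longrightarrow>
      (\<Sum>k\<in>D. norm (x (Sup k) - x (Inf k))) < \<epsilon>"
  proof (intro exI[of _ \<delta>] conjI \<delta> allI impI)
    fix D T assume "D division_of T \<and> T \<subseteq> S' \<and> (\<Sum>k\<in>D. Sup k - Inf k) < \<delta>"
    then show "(\<Sum>k\<in>D. norm (x (Sup k) - x (Inf k))) < \<epsilon>"
      by (elim conjE) (rule small, assumption, rule order_trans[OF _ assms(2)])
  qed
qed

lemma C1_on_imp_continuous_on: "C1_on g S \<Longrightarrow> continuous_on S g"
  unfolding C1_on_def by (elim exE conjE, rule has_derivative_continuous_on) (erule bspec)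

text \<open>
  The derivatives are taken within \<open>S\<close>, so the mean value inequality along segments of the convex set
  \<open>K\<close> applies even where \<open>K\<close> has no interior, as for a lower-dimensional control set.
\<close>

lemma C1_on_imp_lipschitz_on_compact:
  assumes g: "C1_on g S" and K: "compact K" "convex K" "K \<subseteq> S"
  shows "\<exists>M>0. \<forall>z\<in>K. \<forall>w\<in>K. norm (g z - g w) \<le> M * norm (z - w)"
proof -
  obtain g' where g': "\<And>z. z \<in> S \<Longrightarrow> (g has_derivative blinfun_apply (g' z)) (at z within S)"
    and cont: "continuous_on S g'"
    using g unfolding C1_on_def by blast
  have "bounded (g' ` K)"
    using compact_continuous_image[OF continuous_on_subset[OF cont K(3)] K(1)] compact_imp_bounded by blast
  then obtain M where M: "M > 0" "\<And>z. z \<in> K \<Longrightarrow> norm (g' z) \<le> M"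
    unfolding bounded_pos by auto
  have "norm (g z - g w) \<le> M * norm (z - w)" if "z \<in> K" "w \<in> K" for z w
  proof (rule differentiable_bound[OF K(2) _ _ that, where f' = "\<lambda>z. blinfun_apply (g' z)"])
    fix y assume y: "y \<in> K"
    show "(g has_derivative blinfun_apply (g' y)) (at y within K)"
      by (rule has_derivative_subset[OF g' K(3)]) (use y K(3) in auto)
    show "onorm (blinfun_apply (g' y)) \<le> M"
      using M(2)[OF y] by (simp add: norm_blinfun.rep_eq)
  qed
  with M(1) show ?thesis by blast
qed

text \<open>
  Metric projection is preferred to a smooth cut-off function: it is nonexpansive and does not
  increase the norm, so Lipschitz and growth constants survive unchanged.
\<close>

definition radial_cutoff :: "real \<Rightarrow> 'a::euclidean_space \<Rightarrow> 'a" where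
  "radial_cutoff R = closest_point (cball 0 R)"

lemma
  fixes x y :: "'a::euclidean_space"
  assumes "0 \<le> R"
  shows radial_cutoff_in_cball: "norm (radial_cutoff R x) \<le> R"
    and radial_cutoff_nonexpansive: "norm (radial_cutoff R x - radial_cutoff R y) \<le> norm (x - y)"
    and radial_cutoff_norm_le: "norm (radial_cutoff R x) \<le> norm x"
    and continuous_on_radial_cutoff: "continuous_on S (radial_cutoff R :: 'a \<Rightarrow> 'a)"
    and radial_cutoff_id: "norm x \<le> R \<Longrightarrow> radial_cutoff R x = x"
proof -
  have ne: "cball (0::'a) R \<noteq> {}" using assms by auto
  show "norm (radial_cutoff R x) \<le> R"
    using closest_point_exists(1)[OF closed_cball ne, of x] by (simp add: radial_cutoff_def)
  show nonexp: "norm (radial_cutoff R x - radial_cutoff R y) \<le> norm (x - y)" for x y :: 'a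
    using closest_point_lipschitz[OF convex_cball closed_cball ne, of x y] by (simp add: radial_cutoff_def dist_norm)
  show id: "norm x \<le> R \<Longrightarrow> radial_cutoff R x = x" for x :: 'a
    by (simp add: radial_cutoff_def closest_point_self)
  show "norm (radial_cutoff R x) \<le> norm x"
    using nonexp[of x 0] id[of 0] assms by simp
  show "continuous_on S (radial_cutoff R :: 'a \<Rightarrow> 'a)"
    unfolding radial_cutoff_def by (rule continuous_on_closest_point[OF convex_cball closed_cball ne])
qed

section \<open>Trajectories of the control system\<close>

locale control_system =
  fixes f :: "real^'n \<Rightarrow> real^'k \<Rightarrow> real \<Rightarrow> real^'n" and U :: "(real^'k) set"
    and u :: "real \<Rightarrow> real^'k" and T :: real and x0 :: "real^'n"
  assumes compact_U: "compact U" and convex_U: "convex U" and T_nonneg: "0 \<le> T"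
    and f_C1: "C1_on (\<lambda>(x, v, p). f x v p) (UNIV \<times> U \<times> UNIV)"
    and growth: "\<And>p. \<exists>L>0. \<exists>C>0. \<forall>x. \<forall>v\<in>U. norm (f x v p) \<le> L * norm x + C"
    and admissible: "u \<in> admissible_controls T U"
begin

lemma u_in_U: "t \<in> {0..T} \<Longrightarrow> u t \<in> U"
  using admissible by (simp add: admissible_controls_def)

lemma f_continuous: "continuous_on (UNIV \<times> U \<times> UNIV) (\<lambda>(x, v, p). f x v p)"
  by (rule C1_on_imp_continuous_on[OF f_C1])

lemma f_lipschitz_on_ball:
  obtains M where "M > 0" "\<And>x y v p q. \<lbrakk>norm x \<le> R; norm y \<le> R; v \<in> U; p \<in> {\<alpha>..\<beta>}; q \<in> {\<alpha>..\<beta>}\<rbrakk> \<Longrightarrow>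
     norm (f x v p - f y v q) \<le> M * (norm (x - y) + \<bar>p - q\<bar>)"
proof -
  have "compact (cball (0::real^'n) R \<times> U \<times> {\<alpha>..\<beta>})"
    by (intro compact_Times compact_U compact_cball compact_Icc)
  moreover have "convex (cball (0::real^'n) R \<times> U \<times> {\<alpha>..\<beta>})"
    by (intro convex_Times convex_U convex_cball convex_real_interval)
  moreover have "cball (0::real^'n) R \<times> U \<times> {\<alpha>..\<beta>} \<subseteq> UNIV \<times> U \<times> UNIV" by auto
  ultimately obtain M where M: "M > 0" and lip: "\<forall>z\<in>cball 0 R \<times> U \<times> {\<alpha>..\<beta>}. \<forall>w\<in>cball 0 R \<times> U \<times> {\<alpha>..\<beta>}.
      norm ((case z of (x, v, p) \<Rightarrow> f x v p) - (case w of (x, v, p) \<Rightarrow> f x v p)) \<le> M * norm (z - w)"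
    using C1_on_imp_lipschitz_on_compact[OF f_C1] by blast
  have "norm (f x v p - f y v q) \<le> M * (norm (x - y) + \<bar>p - q\<bar>)"
    if *: "norm x \<le> R" "norm y \<le> R" "v \<in> U" "p \<in> {\<alpha>..\<beta>}" "q \<in> {\<alpha>..\<beta>}" for x y v p q
  proof -
    have "norm (f x v p - f y v q) \<le> M * norm ((x, v, p) - (y, v, q))"
      using lip[rule_format, of "(x, v, p)" "(y, v, q)"] * by simp
    also have "norm ((x, v, p) - (y, v, q)) \<le> norm (x - y) + \<bar>p - q\<bar>"
      using norm_Pair_le[of "x - y" "(0, p - q)"] by (simp add: norm_Pair)
    finally show ?thesis using M by simp
  qed
  with M show thesis by (rule that)
qed

lemma bounded_along_continuous:
  assumes x: "continuous_on {0..T} x"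
  obtains B where "0 \<le> B" "\<And>t. t \<in> {0..T} \<Longrightarrow> norm (f (x t) (u t) p) \<le> B"
proof -
  have "compact (x ` {0..T} \<times> U \<times> {p})"
    by (intro compact_Times compact_U compact_continuous_image[OF x]) auto
  then have "bounded ((\<lambda>(x, v, p). f x v p) ` (x ` {0..T} \<times> U \<times> {p}))"
    by (intro compact_imp_bounded compact_continuous_image continuous_on_subset[OF f_continuous]) auto
  then obtain B where B: "B > 0" "\<And>z. z \<in> (\<lambda>(x, v, p). f x v p) ` (x ` {0..T} \<times> U \<times> {p}) \<Longrightarrow> norm z \<le> B"
    unfolding bounded_pos by blast
  have "norm (f (x t) (u t) p) \<le> B" if "t \<in> {0..T}" for t
    by (rule B(2)) (use that u_in_U in \<open>force simp: image_iff\<close>)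
  with B(1) show thesis by (intro that[of B]) auto
qed

text \<open>
  The map \<open>f\<close> is continuous only on the closed set of admissible control values, so measurability of
  the composition is argued in the restricted Borel space, where the triple \<open>(x t, u t, p)\<close> stays.
\<close>

lemma integrable_along_continuous:
  assumes x: "continuous_on {0..T} x"
  shows "(\<lambda>t. f (x t) (u t) p) integrable_on {0..T}"
proof -
  obtain B where B: "\<And>t. t \<in> {0..T} \<Longrightarrow> norm (f (x t) (u t) p) \<le> B"
    using bounded_along_continuous[OF x] by blast
  let ?S = "UNIV \<times> U \<times> UNIV :: ((real^'n) \<times> (real^'k) \<times> real) set"
  have "x \<in> borel_measurable (lebesgue_on {0..T})"
    by (rule continuous_imp_measurable_on_sets_lebesgue[OF x]) auto
  moreover have "u \<in> borel_measurable (lebesgue_on {0..T})"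
    using admissible by (simp add: admissible_controls_def)
  ultimately have "(\<lambda>t. (x t, u t, p)) \<in> borel_measurable (lebesgue_on {0..T})"
    by (intro borel_measurable_Pair measurable_const) auto
  then have "(\<lambda>t. (x t, u t, p)) \<in> lebesgue_on {0..T} \<rightarrow>\<^sub>M restrict_space borel ?S"
    by (rule measurable_restrict_space2[rotated]) (auto simp: u_in_U)
  from measurable_compose[OF this borel_measurable_continuous_on_restrict[OF f_continuous]]
  have "(\<lambda>t. f (x t) (u t) p) \<in> borel_measurable (lebesgue_on {0..T})" by simp
  then show ?thesis
    by (rule measurable_bounded_by_integrable_imp_integrable[where g = "\<lambda>_. B"]) (use B in auto)
qed

definition integral_solution :: "real \<Rightarrow> (real \<Rightarrow> real^'n) \<Rightarrow> bool" where
  "integral_solution p x \<longleftrightarrow> continuous_on {0..T} x \<and>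
     (\<forall>t\<in>{0..T}. x t = x0 + integral {0..t} (\<lambda>s. f (x s) (u s) p))"

lemma integral_solution_cong:
  assumes "\<And>t. t \<in> {0..T} \<Longrightarrow> x t = y t"
  shows "integral_solution p x \<longleftrightarrow> integral_solution p y"
proof -
  have "integral {0..t} (\<lambda>s. f (x s) (u s) p) = integral {0..t} (\<lambda>s. f (y s) (u s) p)" if "t \<in> {0..T}" for t
    using assms that by (intro integral_cong) auto
  then show ?thesis
    unfolding integral_solution_def using assms continuous_on_cong[OF refl, of "{0..T}" x y] by auto
qed

lemma is_solution_iff_integral_solution:
  "is_solution f T x0 u p x \<longleftrightarrow> integral_solution p x"
proof
  assume sol: "is_solution f T x0 u p x"
  let ?D = "\<lambda>t. (x has_vector_derivative f (x t) (u t) p) (at t within {0..T})"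
  have x_0: "x 0 = x0" and ac: "abs_cont_on x {0..T}" and "AE t in lebesgue_on {0..T}. ?D t"
    using sol by (auto simp: is_solution_def)
  then have "AE t in lebesgue. t \<in> {0..T} \<longrightarrow> ?D t"
    by (simp add: AE_restrict_space_iff)
  then obtain N where "N \<in> null_sets lebesgue" "{t \<in> space lebesgue. \<not> (t \<in> {0..T} \<longrightarrow> ?D t)} \<subseteq> N"
    unfolding eventually_ae_filter by blast
  then have N: "negligible N" and D: "\<And>t. t \<in> {0..T} - N \<Longrightarrow> ?D t"
    by (auto simp: negligible_iff_null_sets)
  have "((\<lambda>s. f (x s) (u s) p) has_integral x t - x 0) {0..t}" if t: "t \<in> {0..T}" for t
  proof (rule abs_cont_has_integral_derivative[OF _ _ N])
    show "0 \<le> t" "abs_cont_on x {0..t}"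
      using t abs_cont_on_subset[OF ac] by auto
    show "(x has_vector_derivative f (x s) (u s) p) (at s within {0..t})" if "s \<in> {0..t} - N" for s
      by (rule has_vector_derivative_within_subset[OF D]) (use that t in auto)
  qed
  then have "x t = x0 + integral {0..t} (\<lambda>s. f (x s) (u s) p)" if "t \<in> {0..T}" for t
    using integral_unique[of "\<lambda>s. f (x s) (u s) p" "x t - x 0" "{0..t}"] that x_0 by simp
  then show "integral_solution p x"
    using abs_cont_on_imp_continuous_on[OF ac] by (simp add: integral_solution_def)
next
  assume "integral_solution p x"
  then have cont: "continuous_on {0..T} x"
    and eq: "\<And>t. t \<in> {0..T} \<Longrightarrow> x t = x0 + integral {0..t} (\<lambda>s. f (x s) (u s) p)"
    by (auto simp: integral_solution_def)
  let ?g = "\<lambda>s. f (x s) (u s) p"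
  note int = integrable_along_continuous[OF cont, of p]
  \<comment> \<open>The right-hand side is bounded along \<open>x\<close>, so \<open>x\<close> is even Lipschitz.\<close>
  obtain B where B: "0 \<le> B" "\<And>t. t \<in> {0..T} \<Longrightarrow> norm (?g t) \<le> B"
    using bounded_along_continuous[OF cont] by blast
  have forward: "norm (x t - x s) \<le> B * \<bar>t - s\<bar>" if "s \<in> {0..T}" "t \<in> {0..T}" "s \<le> t" for s t
  proof -
    have int_t: "?g integrable_on {0..t}" "?g integrable_on {s..t}"
      by (rule integrable_subinterval_real[OF int]; use that in auto)+
    have "x t - x s = integral {s..t} ?g"
      using eq[OF that(1)] eq[OF that(2)] that Henstock_Kurzweil_Integration.integral_combine[OF _ that(3) int_t(1)]
      by (auto simp: algebra_simps)
    also have "norm \<dots> \<le> integral {s..t} (\<lambda>_. B)"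
      using int_t(2) B that by (intro integral_norm_bound_integral) auto
    finally show ?thesis using that by (simp add: mult.commute)
  qed
  have "abs_cont_on x {0..T}"
  proof (rule lipschitz_imp_abs_cont_on[OF _ B(1)])
    fix s t assume "s \<in> {0..T}" "t \<in> {0..T}"
    then show "norm (x t - x s) \<le> B * \<bar>t - s\<bar>"
      using forward[of s t] forward[of t s] by (cases "s \<le> t") (auto simp: norm_minus_commute abs_minus_commute)
  qed
  moreover have "AE t in lebesgue_on {0..T}. (x has_vector_derivative ?g t) (at t within {0..T})"
  proof -
    obtain N where N: "negligible N" and D: "\<And>t. t \<in> {0..T} - N \<Longrightarrow>
        ((\<lambda>s. integral {0..s} ?g) has_vector_derivative ?g t) (at t within {0..T})"
      using negligible_non_differentiability_indefinite_integral[OF int] by blast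
    have "(x has_vector_derivative ?g t) (at t within {0..T})" if t: "t \<in> {0..T} - N" for t
    proof -
      have "((\<lambda>s. x0 + integral {0..s} ?g) has_vector_derivative ?g t) (at t within {0..T})"
        using has_vector_derivative_add[OF has_vector_derivative_const D[OF t]] by simp
      then show ?thesis
        by (rule has_vector_derivative_transform[rotated 2]) (use t eq in auto)
    qed
    then have "AE t in lebesgue. t \<in> {0..T} \<longrightarrow> (x has_vector_derivative ?g t) (at t within {0..T})"
      using N by (intro AE_I'[of N]) (auto simp: negligible_iff_null_sets)
    then show ?thesis by (simp add: AE_restrict_space_iff)
  qed
  moreover have "x 0 = x0" using eq[of 0] T_nonneg by simp
  ultimately show "is_solution f T x0 u p x" by (simp add: is_solution_def)
qed

text \<open>
  Only the state argument is cut off: the control values already lie in a compact set, and the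
  parameter is fixed along a trajectory.
\<close>

definition truncated_solution :: "real \<Rightarrow> real \<Rightarrow> (real \<Rightarrow> real^'n) \<Rightarrow> bool" where
  "truncated_solution R p x \<longleftrightarrow> continuous_on {0..T} x \<and>
     (\<forall>t\<in>{0..T}. x t = x0 + integral {0..t} (\<lambda>s. f (radial_cutoff R (x s)) (u s) p))"

lemma truncated_solution_iff:
  assumes "0 \<le> R" "\<And>t. t \<in> {0..T} \<Longrightarrow> norm (x t) \<le> R"
  shows "truncated_solution R p x \<longleftrightarrow> integral_solution p x"
proof -
  have "integral {0..t} (\<lambda>s. f (radial_cutoff R (x s)) (u s) p) = integral {0..t} (\<lambda>s. f (x s) (u s) p)"
    if "t \<in> {0..T}" for t
    using assms that by (intro integral_cong) (simp add: radial_cutoff_id)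
  then show ?thesis by (simp add: truncated_solution_def integral_solution_def)
qed

lemma truncated_integrable:
  assumes "0 \<le> R" "continuous_on {0..T} x" "t \<in> {0..T}"
  shows "(\<lambda>s. f (radial_cutoff R (x s)) (u s) p) integrable_on {0..t}"
proof -
  have "continuous_on {0..T} (\<lambda>s. radial_cutoff R (x s))"
    using continuous_on_compose2[OF continuous_on_radial_cutoff[OF assms(1), of UNIV] assms(2)] by simp
  from integrable_along_continuous[OF this] show ?thesis
    by (rule integrable_subinterval_real) (use assms(3) in auto)
qed

lemma truncated_solution_exists:
  assumes R: "0 \<le> R"
  shows "\<exists>x. truncated_solution R p x"
proof -
  obtain M where M: "M > 0" and lip: "\<And>x y v q r. \<lbrakk>norm x \<le> R; norm y \<le> R; v \<in> U; q \<in> {p..p}; r \<in> {p..p}\<rbrakk> \<Longrightarrow>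
     norm (f x v q - f y v r) \<le> M * (norm (x - y) + \<bar>q - r\<bar>)"
    using f_lipschitz_on_ball by blast
  show ?thesis
    unfolding truncated_solution_def
  proof (rule Picard_integral_equation[OF T_nonneg M])
    fix t :: real and x y :: "real^'n" assume "t \<in> {0..T}"
    then have "norm (f (radial_cutoff R x) (u t) p - f (radial_cutoff R y) (u t) p) \<le>
        M * norm (radial_cutoff R x - radial_cutoff R y)"
      using lip[of "radial_cutoff R x" "radial_cutoff R y" "u t" p p] u_in_U[of t]
      by (simp add: radial_cutoff_in_cball[OF R])
    also have "\<dots> \<le> M * norm (x - y)"
      using M radial_cutoff_nonexpansive[OF R] by (intro mult_left_mono) auto
    finally show "norm (f (radial_cutoff R x) (u t) p - f (radial_cutoff R y) (u t) p) \<le> M * norm (x - y)" .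
  qed (use truncated_integrable[OF R] T_nonneg in auto)
qed

text \<open>
  The bound does not depend on the radius \<open>R\<close>. This makes it usable as a radius itself, for which the
  cut-off then has no effect on the trajectory.
\<close>

lemma truncated_solution_a_priori_bound:
  obtains B where "0 \<le> B" "\<And>R x t. 0 \<le> R \<Longrightarrow> truncated_solution R p x \<Longrightarrow> t \<in> {0..T} \<Longrightarrow> norm (x t) \<le> B"
proof -
  obtain L C where L: "L > 0" and C: "C > 0" and LC: "\<And>x v. v \<in> U \<Longrightarrow> norm (f x v p) \<le> L * norm x + C"
    using growth[of p] by blast
  define c where "c = norm x0 + C * T"
  have "norm (x t) \<le> c * exp (L * T)"
    if R: "0 \<le> R" and x: "truncated_solution R p x" and t: "t \<in> {0..T}" for R x t
  proof -
    have cont: "continuous_on {0..T} x"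
      and eq: "\<And>t. t \<in> {0..T} \<Longrightarrow> x t = x0 + integral {0..t} (\<lambda>s. f (radial_cutoff R (x s)) (u s) p)"
      using x by (auto simp: truncated_solution_def)
    have "norm (x t) \<le> c * exp (L * t)"
    proof (rule gronwall_integral[where \<phi> = "\<lambda>t. norm (x t)", OF _ _ _ t])
      show "continuous_on {0..T} (\<lambda>t. norm (x t))" by (intro continuous_on_norm cont)
      fix t assume t: "t \<in> {0..T}"
      have norm_int: "(\<lambda>s. norm (x s)) integrable_on {0..t}"
        by (intro integrable_continuous_real continuous_on_norm continuous_on_subset[OF cont]) (use t in auto)
      have "norm (integral {0..t} (\<lambda>s. f (radial_cutoff R (x s)) (u s) p)) \<le> integral {0..t} (\<lambda>s. L * norm (x s) + C)"
      proof (rule integral_norm_bound_integral)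
        show "(\<lambda>s. f (radial_cutoff R (x s)) (u s) p) integrable_on {0..t}"
          by (rule truncated_integrable[OF R cont t])
        show "(\<lambda>s. L * norm (x s) + C) integrable_on {0..t}"
          by (intro integrable_add integrable_on_mult_right norm_int) auto
        fix s assume s: "s \<in> {0..t}"
        have "norm (f (radial_cutoff R (x s)) (u s) p) \<le> L * norm (radial_cutoff R (x s)) + C"
          using s t by (intro LC u_in_U) auto
        also have "\<dots> \<le> L * norm (x s) + C"
          using L radial_cutoff_norm_le[OF R, of "x s"] by simp
        finally show "norm (f (radial_cutoff R (x s)) (u s) p) \<le> L * norm (x s) + C" .
      qed
      also have "\<dots> = L * integral {0..t} (\<lambda>s. norm (x s)) + C * t"
        using norm_int t by (subst integral_add) (auto simp: mult.commute intro: integrable_on_mult_right)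
      also have "\<dots> \<le> L * integral {0..t} (\<lambda>s. norm (x s)) + C * T"
        using C t by simp
      finally show "norm (x t) \<le> c + L * integral {0..t} (\<lambda>s. norm (x s))"
        using eq[OF t] norm_triangle_ineq[of x0 "integral {0..t} (\<lambda>s. f (radial_cutoff R (x s)) (u s) p)"]
        by (simp add: c_def)
    qed (use L in auto)
    also have "\<dots> \<le> c * exp (L * T)"
      using L C T_nonneg t by (intro mult_left_mono) (auto simp: c_def)
    finally show ?thesis .
  qed
  moreover have "0 \<le> c * exp (L * T)"
    using C T_nonneg by (simp add: c_def)
  ultimately show thesis by (rule that[rotated])
qed

text \<open>
  The constant serves all parameters of a bounded interval at once, since the cut-off right-hand side
  has one Lipschitz constant there. For \<open>p = q\<close> it says that cut-off trajectories are unique.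
\<close>

lemma truncated_solution_stability:
  assumes R: "0 \<le> R"
  shows "\<exists>M\<ge>0. \<forall>p\<in>{\<alpha>..\<beta>}. \<forall>q\<in>{\<alpha>..\<beta>}. \<forall>x y. truncated_solution R p x \<longrightarrow>
     truncated_solution R q y \<longrightarrow> (\<forall>t\<in>{0..T}. norm (x t - y t) \<le> M * \<bar>p - q\<bar>)"
proof -
  obtain M where M: "M > 0" and lip: "\<And>x y v p q. \<lbrakk>norm x \<le> R; norm y \<le> R; v \<in> U; p \<in> {\<alpha>..\<beta>}; q \<in> {\<alpha>..\<beta>}\<rbrakk> \<Longrightarrow>
     norm (f x v p - f y v q) \<le> M * (norm (x - y) + \<bar>p - q\<bar>)"
    using f_lipschitz_on_ball by blast
  have "norm (x t - y t) \<le> M * T * exp (M * T) * \<bar>p - q\<bar>"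
    if p: "p \<in> {\<alpha>..\<beta>}" and q: "q \<in> {\<alpha>..\<beta>}" and x: "truncated_solution R p x" and y: "truncated_solution R q y"
      and t: "t \<in> {0..T}" for p q x y t
  proof -
    let ?g = "\<lambda>x p s. f (radial_cutoff R (x s)) (u s) p"
    have cont: "continuous_on {0..T} x" "continuous_on {0..T} y"
      and eq: "\<And>t. t \<in> {0..T} \<Longrightarrow> x t = x0 + integral {0..t} (?g x p)"
        "\<And>t. t \<in> {0..T} \<Longrightarrow> y t = x0 + integral {0..t} (?g y q)"
      using x y by (auto simp: truncated_solution_def)
    have cont_diff: "continuous_on {0..T} (\<lambda>t. norm (x t - y t))"
      by (intro continuous_intros cont)
    have "norm (x t - y t) \<le> M * T * \<bar>p - q\<bar> * exp (M * t)"
    proof (rule gronwall_integral[where \<phi> = "\<lambda>t. norm (x t - y t)", OF cont_diff _ _ t])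
      fix t assume t: "t \<in> {0..T}"
      have norm_int: "(\<lambda>s. norm (x s - y s)) integrable_on {0..t}"
        by (intro integrable_continuous_real continuous_on_subset[OF cont_diff]) (use t in auto)
      note g_int = truncated_integrable[OF R cont(1) t, of p] truncated_integrable[OF R cont(2) t, of q]
      have "norm (x t - y t) = norm (integral {0..t} (\<lambda>s. ?g x p s - ?g y q s))"
        using eq(1)[OF t] eq(2)[OF t] g_int by (simp add: integral_diff)
      also have "\<dots> \<le> integral {0..t} (\<lambda>s. M * norm (x s - y s) + M * \<bar>p - q\<bar>)"
      proof (rule integral_norm_bound_integral)
        show "(\<lambda>s. ?g x p s - ?g y q s) integrable_on {0..t}"
          by (intro integrable_diff g_int)
        show "(\<lambda>s. M * norm (x s - y s) + M * \<bar>p - q\<bar>) integrable_on {0..t}"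
          by (intro integrable_add integrable_on_mult_right norm_int) auto
        fix s assume s: "s \<in> {0..t}"
        have "norm (?g x p s - ?g y q s) \<le> M * (norm (radial_cutoff R (x s) - radial_cutoff R (y s)) + \<bar>p - q\<bar>)"
          using s t p q by (intro lip u_in_U radial_cutoff_in_cball R) auto
        also have "\<dots> \<le> M * (norm (x s - y s) + \<bar>p - q\<bar>)"
          using M radial_cutoff_nonexpansive[OF R, of "x s" "y s"] by simp
        finally show "norm (?g x p s - ?g y q s) \<le> M * norm (x s - y s) + M * \<bar>p - q\<bar>"
          by (simp add: distrib_left)
      qed
      also have "\<dots> = M * integral {0..t} (\<lambda>s. norm (x s - y s)) + M * \<bar>p - q\<bar> * t"
        using norm_int t by (subst integral_add) (auto simp: mult.commute intro: integrable_on_mult_right)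
      also have "\<dots> \<le> M * T * \<bar>p - q\<bar> + M * integral {0..t} (\<lambda>s. norm (x s - y s))"
        using M t mult_left_mono[of t T "M * \<bar>p - q\<bar>"] by (simp add: mult_ac)
      finally show "norm (x t - y t) \<le> M * T * \<bar>p - q\<bar> + M * integral {0..t} (\<lambda>s. norm (x s - y s))" .
    qed (use M in auto)
    also have "\<dots> \<le> M * T * \<bar>p - q\<bar> * exp (M * T)"
      using M T_nonneg t by (intro mult_left_mono) auto
    finally show ?thesis by (simp add: mult_ac)
  qed
  moreover have "0 \<le> M * T * exp (M * T)" using M T_nonneg by simp
  ultimately show ?thesis by (intro exI[of _ "M * T * exp (M * T)"]) blast
qed

lemma integral_solution_bounded:
  assumes "integral_solution p x"
  obtains B where "0 \<le> B" "\<And>t. t \<in> {0..T} \<Longrightarrow> norm (x t) \<le> B"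
proof -
  have "bounded (x ` {0..T})"
    using assms by (intro compact_imp_bounded compact_continuous_image) (auto simp: integral_solution_def)
  then show thesis unfolding bounded_pos using that by (metis image_eqI less_imp_le)
qed

text \<open>
  A trajectory cut off at the radius \<open>B\<close> of the a priori bound never leaves that ball.
\<close>

lemma integral_solution_exists: "\<exists>x. integral_solution p x"
proof -
  obtain B where B: "0 \<le> B"
    and bound: "\<And>R x t. 0 \<le> R \<Longrightarrow> truncated_solution R p x \<Longrightarrow> t \<in> {0..T} \<Longrightarrow> norm (x t) \<le> B"
    using truncated_solution_a_priori_bound by blast
  obtain x where x: "truncated_solution B p x" using truncated_solution_exists[OF B] by blast
  have "truncated_solution B p x \<longleftrightarrow> integral_solution p x"
    by (rule truncated_solution_iff[OF B bound[OF B x]])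
  with x show ?thesis by blast
qed

lemma integral_solution_unique:
  assumes x: "integral_solution p x" and y: "integral_solution p y" and t: "t \<in> {0..T}"
  shows "x t = y t"
proof -
  obtain B1 B2 where B: "0 \<le> B1" "0 \<le> B2" "\<And>t. t \<in> {0..T} \<Longrightarrow> norm (x t) \<le> B1" "\<And>t. t \<in> {0..T} \<Longrightarrow> norm (y t) \<le> B2"
    using integral_solution_bounded[OF x] integral_solution_bounded[OF y] by metis
  define R where "R = B1 + B2"
  have R: "0 \<le> R" "\<And>t. t \<in> {0..T} \<Longrightarrow> norm (x t) \<le> R" "\<And>t. t \<in> {0..T} \<Longrightarrow> norm (y t) \<le> R"
    using B by (auto simp: R_def add_increasing add_increasing2)
  have "truncated_solution R p x" "truncated_solution R p y"
    using truncated_solution_iff[OF R(1,2), where p = p] truncated_solution_iff[OF R(1,3), where p = p] x y by simp_all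
  moreover obtain M where "\<forall>q\<in>{p..p}. \<forall>r\<in>{p..p}. \<forall>x y. truncated_solution R q x \<longrightarrow>
     truncated_solution R r y \<longrightarrow> (\<forall>t\<in>{0..T}. norm (x t - y t) \<le> M * \<bar>q - r\<bar>)"
    using truncated_solution_stability[OF R(1), of p p] by blast
  ultimately have "norm (x t - y t) \<le> M * \<bar>p - p\<bar>" using t by simp
  then show ?thesis by simp
qed

lemma integral_solution_solution: "integral_solution p (solution f T x0 u p)"
proof -
  obtain x where x: "integral_solution p x" using integral_solution_exists by blast
  have "\<exists>!x. x \<in> extensional {0..T} \<and> is_solution f T x0 u p x"
  proof (rule ex1I[of _ "restrict x {0..T}"])
    show "restrict x {0..T} \<in> extensional {0..T} \<and> is_solution f T x0 u p (restrict x {0..T})"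
      using x integral_solution_cong[of "restrict x {0..T}" x p] by (simp add: is_solution_iff_integral_solution)
    show "y = restrict x {0..T}" if "y \<in> extensional {0..T} \<and> is_solution f T x0 u p y" for y
      using that integral_solution_unique[OF _ x]
      by (intro extensionalityI[of y "{0..T}"]) (auto simp: is_solution_iff_integral_solution)
  qed
  from theI'[OF this] show ?thesis
    by (simp add: solution_def is_solution_iff_integral_solution)
qed

text \<open>
  Continuity at \<open>p\<close> is obtained from trajectories cut off at a radius adapted to \<open>p\<close> alone. For \<open>q\<close>
  near \<open>p\<close> the cut-off trajectory of \<open>q\<close> stays within distance 1 of that of \<open>p\<close>, hence is genuine, and
  uniqueness identifies it with the solution.
\<close>

theorem solution_continuous_in_parameter:
  assumes t: "t \<in> {0..T}"
  shows "continuous_on S (\<lambda>p. solution f T x0 u p t)"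
proof -
  have "\<exists>d>0. \<forall>q. dist q p < d \<longrightarrow> dist (solution f T x0 u q t) (solution f T x0 u p t) < e"
    if e: "e > 0" for p e
  proof -
    define x where "x = solution f T x0 u p"
    have x: "integral_solution p x" unfolding x_def by (rule integral_solution_solution)
    obtain B where B: "0 \<le> B" "\<And>t. t \<in> {0..T} \<Longrightarrow> norm (x t) \<le> B"
      using integral_solution_bounded[OF x] by blast
    define R where "R = B + 1"
    have R: "0 \<le> R" using B by (simp add: R_def)
    have x_trunc: "truncated_solution R p x"
      using x B R truncated_solution_iff[OF R, of x p] by (force simp: R_def)
    obtain M where M: "0 \<le> M" and stab: "\<forall>r\<in>{p - 1..p + 1}. \<forall>q\<in>{p - 1..p + 1}. \<forall>x y.
        truncated_solution R r x \<longrightarrow> truncated_solution R q y \<longrightarrow> (\<forall>t\<in>{0..T}. norm (x t - y t) \<le> M * \<bar>r - q\<bar>)"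
      using truncated_solution_stability[OF R, of "p - 1" "p + 1"] by blast
    \<comment> \<open>\<open>d \<le> 1\<close> keeps \<open>q\<close> where \<open>M\<close> is valid; deviation below 1 keeps the trajectory in the ball.\<close>
    define d where "d = min 1 (min 1 e / (M + 1))"
    have d: "d > 0" "d \<le> 1" "M * d < min 1 e"
    proof -
      show "d > 0" "d \<le> 1" using M e by (auto simp: d_def)
      have "M * d \<le> M * (min 1 e / (M + 1))"
        using M by (intro mult_left_mono) (auto simp: d_def)
      also have "M * (c / (M + 1)) < c" if "c > 0" for c
        using that M by (simp add: field_simps)
      from this[of "min 1 e"] e have "M * (min 1 e / (M + 1)) < min 1 e" by simp
      finally show "M * d < min 1 e" .
    qed
    have "dist (solution f T x0 u q t) (x t) < e" if q: "dist q p < d" for q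
    proof -
      obtain y where y: "truncated_solution R q y" using truncated_solution_exists[OF R] by blast
      have close: "norm (x s - y s) < min 1 e" if "s \<in> {0..T}" for s
      proof -
        have "norm (x s - y s) \<le> M * \<bar>p - q\<bar>"
          using q d by (intro stab[rule_format, OF _ _ x_trunc y that]) (auto simp: dist_real_def)
        also have "\<dots> \<le> M * d" using q M by (intro mult_left_mono) (auto simp: dist_real_def)
        finally show ?thesis using d by simp
      qed
      have "norm (y s) \<le> R" if "s \<in> {0..T}" for s
        using close[OF that] B(2)[OF that] norm_triangle_ineq2[of "y s" "x s"]
        by (simp add: R_def norm_minus_commute)
      then have "integral_solution q y" using truncated_solution_iff[OF R, of y q] y by blast
      then have "solution f T x0 u q t = y t"
        by (rule integral_solution_unique[OF integral_solution_solution _ t])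
      then show ?thesis using close[OF t] by (simp add: dist_norm norm_minus_commute)
    qed
    with d(1) show ?thesis unfolding x_def by blast
  qed
  then show ?thesis unfolding continuous_on_iff by blast
qed

end

section \<open>The Lebesgue-Stieltjes measure and weighted Riemann sums\<close>

text \<open>
  The density is only Lebesgue measurable, whereas the Lebesgue-Stieltjes measure lives on the Borel
  sets, so a Borel representative is needed to write it as a measure with density.
\<close>

lemma borel_version_of_density:
  assumes pdf: "is_pdf_on a b \<psi>"
  obtains w where "w \<in> borel_measurable borel" "\<And>p. 0 \<le> w p"
    "AE p in lborel. w p = indicator {a..b} p * \<psi> p"
proof -
  let ?w = "\<lambda>p. indicator {a..b} p * \<psi> p"
  have "integrable lebesgue ?w"
    using pdf by (simp add: is_pdf_on_def set_integrable_def)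
  then have "?w \<in> borel_measurable (completion lborel)" by blast
  then obtain w where w: "w \<in> borel_measurable lborel" "AE p in lborel. ?w p = w p"
    using completion_ex_borel_measurable_real by blast
  show thesis
  proof (rule that[of "\<lambda>p. max 0 (w p)"])
    show "AE p in lborel. max 0 (w p) = ?w p"
      using w(2)
    proof eventually_elim
      fix p assume "?w p = w p"
      moreover have "0 \<le> ?w p" using pdf by (auto simp: is_pdf_on_def indicator_def)
      ultimately show "max 0 (w p) = ?w p" by simp
    qed
  qed (use w in auto)
qed

text \<open>
  The probability measure with density \<open>\<psi>\<close> on \<open>[a, b]\<close> has the distribution function \<open>F\<close>, and a
  probability measure on the line is determined by its distribution function. That \<open>F\<close> is monotone,
  right-continuous and has the correct limits comes for free in this way.
\<close>

lemma integral_distribution_function: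
  fixes \<phi> :: "real \<Rightarrow> real"
  assumes pdf: "is_pdf_on a b \<psi>" and \<phi>: "continuous_on {a..b} \<phi>"
  shows "(LINT p:{a..b}|interval_measure (distribution_function a b \<psi>). \<phi> p) = (LINT p:{a..b}|lebesgue. \<phi> p * \<psi> p)"
proof -
  obtain w where w: "w \<in> borel_measurable borel" "\<And>p. 0 \<le> w p"
    and w_eq: "AE p in lborel. w p = indicator {a..b} p * \<psi> p"
    using borel_version_of_density[OF pdf] by blast
  have w_eq': "AE p in lebesgue. w p = indicator {a..b} p * \<psi> p"
    using w_eq by (simp add: AE_completion_iff)
  have \<psi>_meas: "(\<lambda>p. indicator {a..b} p * \<psi> p) \<in> borel_measurable lebesgue"
    using pdf by (intro borel_measurable_integrable) (simp add: is_pdf_on_def set_integrable_def)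
  define M where "M = density lborel (\<lambda>p. ennreal (w p))"
  have integrable_w: "integrable lborel w" and integral_w: "integral\<^sup>L lborel w = 1"
  proof -
    have "integrable lebesgue (\<lambda>p. indicator {a..b} p * \<psi> p)" "integral\<^sup>L lebesgue (\<lambda>p. indicator {a..b} p * \<psi> p) = 1"
      using pdf by (simp_all add: is_pdf_on_def set_integrable_def set_lebesgue_integral_def)
    moreover have "w \<in> borel_measurable lebesgue" using w(1) by (simp add: measurable_completion)
    ultimately have "integrable lebesgue w" "integral\<^sup>L lebesgue w = 1"
      using w_eq' integrable_cong_AE[of w lebesgue "\<lambda>p. indicator {a..b} p * \<psi> p"]
        integral_cong_AE[of w lebesgue "\<lambda>p. indicator {a..b} p * \<psi> p"] by auto
    then show "integrable lborel w" "integral\<^sup>L lborel w = 1"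
      using w(1) by (simp_all add: integrable_completion integral_completion)
  qed
  have dist: "real_distribution M"
  proof -
    have "emeasure M UNIV = 1"
      using w integrable_w integral_w unfolding M_def by (simp add: emeasure_density nn_integral_eq_integral)
    then show ?thesis
      by (auto simp: real_distribution_def real_distribution_axioms_def M_def intro!: prob_spaceI)
  qed
  interpret real_distribution M by (rule dist)
  have cdf_M: "cdf M = distribution_function a b \<psi>"
  proof
    fix x
    have "cdf M x = integral\<^sup>L M (indicator {..x})"
      by (simp add: cdf_def M_def)
    also have "\<dots> = integral\<^sup>L lborel (\<lambda>p. w p * indicator {..x} p)"
      unfolding M_def using w by (subst integral_density) auto
    also have "\<dots> = integral\<^sup>L lebesgue (\<lambda>p. w p * indicator {..x} p)"
      using w by (subst integral_completion) auto
    also have "\<dots> = integral\<^sup>L lebesgue (\<lambda>p. indicator ({a..b} \<inter> {..x}) p * \<psi> p)"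
    proof (rule integral_cong_AE)
      show "(\<lambda>p. w p * indicator {..x} p) \<in> borel_measurable lebesgue"
        using w by (intro measurable_completion) auto
      have "(\<lambda>p. indicator {a..b} p * \<psi> p * indicator {..x} p) \<in> borel_measurable lebesgue"
        by (intro borel_measurable_times[OF \<psi>_meas] borel_measurable_indicator) simp
      then show "(\<lambda>p. indicator ({a..b} \<inter> {..x}) p * \<psi> p) \<in> borel_measurable lebesgue"
        by (rule measurable_cong[THEN iffD1, rotated]) (simp add: indicator_def)
      show "AE p in lebesgue. w p * indicator {..x} p = indicator ({a..b} \<inter> {..x}) p * \<psi> p"
        using w_eq' by eventually_elim (simp add: indicator_def)
    qed
    finally show "cdf M x = distribution_function a b \<psi> x"
      by (simp add: distribution_function_def set_lebesgue_integral_def)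
  qed
  have "interval_measure (cdf M) = M"
  proof (rule cdf_unique[OF _ dist])
    show "real_distribution (interval_measure (cdf M))"
      by (rule real_distribution_interval_measure)
        (auto intro: cdf_nondecreasing cdf_is_right_cont cdf_lim_at_bot cdf_lim_at_top_prob)
    show "cdf (interval_measure (cdf M)) = cdf M"
      by (rule cdf_interval_measure) (auto intro: cdf_nondecreasing cdf_is_right_cont cdf_lim_at_bot)
  qed
  then have "(LINT p:{a..b}|interval_measure (distribution_function a b \<psi>). \<phi> p) = (LINT p:{a..b}|M. \<phi> p)"
    by (simp add: cdf_M)
  also have "\<dots> = integral\<^sup>L lborel (\<lambda>p. w p * (indicator {a..b} p * \<phi> p))"
    unfolding M_def set_lebesgue_integral_def
    using w borel_measurable_continuous_on_indicator[OF _ \<phi>] by (subst integral_density) auto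
  also have "\<dots> = integral\<^sup>L lebesgue (\<lambda>p. w p * (indicator {a..b} p * \<phi> p))"
    using w borel_measurable_continuous_on_indicator[OF _ \<phi>] by (subst integral_completion) auto
  also have "\<dots> = integral\<^sup>L lebesgue (\<lambda>p. indicator {a..b} p * (\<phi> p * \<psi> p))"
  proof (rule integral_cong_AE)
    have ind: "(\<lambda>p. indicator {a..b} p * \<phi> p) \<in> borel_measurable lebesgue"
      using borel_measurable_continuous_on_indicator[OF _ \<phi>] by (intro measurable_completion) auto
    show "(\<lambda>p. w p * (indicator {a..b} p * \<phi> p)) \<in> borel_measurable lebesgue"
      by (rule borel_measurable_times[OF measurable_completion ind]) (use w in simp)
    have "(\<lambda>p. (indicator {a..b} p * \<phi> p) * (indicator {a..b} p * \<psi> p)) \<in> borel_measurable lebesgue"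
      by (rule borel_measurable_times[OF ind \<psi>_meas])
    then show "(\<lambda>p. indicator {a..b} p * (\<phi> p * \<psi> p)) \<in> borel_measurable lebesgue"
      by (rule measurable_cong[THEN iffD1, rotated]) (simp add: indicator_def)
    show "AE p in lebesgue. w p * (indicator {a..b} p * \<phi> p) = indicator {a..b} p * (\<phi> p * \<psi> p)"
      using w_eq' by eventually_elim (simp add: indicator_def)
  qed
  finally show ?thesis by (simp add: set_lebesgue_integral_def)
qed

lemma partition_mono:
  assumes "is_partition a b m P" "i \<le> j" "j \<le> m"
  shows "P i \<le> P j"
  using assms(2,3)
proof (induction j rule: dec_induct)
  case (step j)
  have "P j < P (Suc j)" using assms(1) step by (auto simp: is_partition_def dest: bspec[of _ _ "Suc j"])
  then show ?case using step by simp
qed simp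

lemma integral_partition:
  fixes g :: "real \<Rightarrow> real"
  assumes P: "is_partition a b m P" and g: "g integrable_on {a..b}"
  shows "integral {a..b} g = (\<Sum>i = 1..m. integral {P (i - 1)..P i} g)"
proof -
  have ends: "P 0 = a" "P m = b" using P by (auto simp: is_partition_def)
  have "integral {a..P k} g = (\<Sum>i = 1..k. integral {P (i - 1)..P i} g)" if "k \<le> m" for k
    using that
  proof (induction k)
    case 0
    then show ?case by (simp add: ends)
  next
    case (Suc k)
    have le: "a \<le> P k" "P k \<le> P (Suc k)" "P (Suc k) \<le> b"
      using partition_mono[OF P, of 0 k] partition_mono[OF P, of k "Suc k"] partition_mono[OF P, of "Suc k" m] Suc.prems ends
      by auto
    have "g integrable_on {a..P (Suc k)}"
      by (rule integrable_subinterval_real[OF g]) (use le in auto)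
    from Henstock_Kurzweil_Integration.integral_combine[OF le(1,2) this] Suc show ?case by simp
  qed
  from this[of m] show ?thesis by (simp add: ends)
qed

lemma partition_cell_weights:
  assumes pdf: "is_pdf_on a b \<psi>" and P: "is_partition a b m P"
  shows cell_weight_eq_integral: "\<And>i. i \<in> {1..m} \<Longrightarrow> cell_weight \<psi> P i = integral {P (i - 1)..P i} \<psi>"
    and cell_subset: "\<And>i. i \<in> {1..m} \<Longrightarrow> {P (i - 1)..P i} \<subseteq> {a..b}"
    and sum_cell_weight: "(\<Sum>i = 1..m. cell_weight \<psi> P i) = 1"
proof -
  have ends: "P 0 = a" "P m = b" using P by (auto simp: is_partition_def)
  have int: "set_integrable lebesgue {a..b} \<psi>" using pdf by (simp add: is_pdf_on_def)
  show sub: "{P (i - 1)..P i} \<subseteq> {a..b}" if "i \<in> {1..m}" for i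
    using that partition_mono[OF P, of 0 "i - 1"] partition_mono[OF P, of i m] ends by auto
  show eq: "cell_weight \<psi> P i = integral {P (i - 1)..P i} \<psi>" if "i \<in> {1..m}" for i
    unfolding cell_weight_def
    by (intro set_lebesgue_integral_eq_integral(2) set_integrable_subset[OF int] sub[OF that]) auto
  have "(\<Sum>i = 1..m. cell_weight \<psi> P i) = integral {a..b} \<psi>"
    using eq integral_partition[OF P set_lebesgue_integral_eq_integral(1)[OF int]] by simp
  then show "(\<Sum>i = 1..m. cell_weight \<psi> P i) = 1"
    using set_lebesgue_integral_eq_integral(2)[OF int] pdf by (simp add: is_pdf_on_def)
qed

text \<open>
  On each cell the error is at most \<open>\<epsilon>\<close> times the cell weight by uniform continuity of \<open>\<phi>\<close>, and the
  weights sum to 1.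
\<close>

theorem weighted_Riemann_sum_approximation:
  fixes \<phi> :: "real \<Rightarrow> real"
  assumes pdf: "is_pdf_on a b \<psi>" and \<phi>: "continuous_on {a..b} \<phi>" and \<epsilon>: "0 < \<epsilon>"
  shows "\<exists>\<delta>>0. \<forall>m P d. is_partition a b m P \<and> (\<forall>i\<in>{1..m}. P (i - 1) \<le> d i \<and> d i < P i) \<and> grid_size m P \<le> \<delta> \<longrightarrow>
     \<bar>(LINT p:{a..b}|lebesgue. \<phi> p * \<psi> p) - (\<Sum>i = 1..m. \<phi> (d i) * cell_weight \<psi> P i)\<bar> \<le> \<epsilon>"
proof -
  have \<psi>_int: "\<psi> absolutely_integrable_on {a..b}" and \<psi>_nonneg: "\<And>p. p \<in> {a..b} \<Longrightarrow> 0 \<le> \<psi> p"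
    using pdf by (auto simp: is_pdf_on_def)
  have prod_int: "(\<lambda>p. \<phi> p * \<psi> p) absolutely_integrable_on {a..b}"
  proof (rule absolutely_integrable_bounded_measurable_product_real)
    show "\<phi> \<in> borel_measurable (lebesgue_on {a..b})"
      by (rule continuous_imp_measurable_on_sets_lebesgue[OF \<phi>]) auto
    show "bounded (\<phi> ` {a..b})"
      by (intro compact_imp_bounded compact_continuous_image \<phi>) auto
  qed (use \<psi>_int in auto)
  obtain \<delta> where \<delta>: "\<delta> > 0" and unif: "\<And>p q. p \<in> {a..b} \<Longrightarrow> q \<in> {a..b} \<Longrightarrow> dist q p < \<delta> \<Longrightarrow> dist (\<phi> q) (\<phi> p) < \<epsilon>"
    using compact_uniformly_continuous[OF \<phi> compact_Icc] \<epsilon> unfolding uniformly_continuous_on_def by metis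
  have "\<bar>(LINT p:{a..b}|lebesgue. \<phi> p * \<psi> p) - (\<Sum>i = 1..m. \<phi> (d i) * cell_weight \<psi> P i)\<bar> \<le> \<epsilon>"
    if P: "is_partition a b m P" and d: "\<forall>i\<in>{1..m}. P (i - 1) \<le> d i \<and> d i < P i" and grid: "grid_size m P \<le> \<delta> / 2" for m P d
  proof -
    note weight = cell_weight_eq_integral[OF pdf P] and sub = cell_subset[OF pdf P]
    have cell: "\<bar>integral {P (i - 1)..P i} (\<lambda>p. \<phi> p * \<psi> p) - \<phi> (d i) * cell_weight \<psi> P i\<bar> \<le> \<epsilon> * cell_weight \<psi> P i"
      if i: "i \<in> {1..m}" for i
    proof -
      let ?C = "{P (i - 1)..P i}"
      have int: "\<psi> integrable_on ?C" "(\<lambda>p. \<phi> p * \<psi> p) integrable_on ?C"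
        using \<psi>_int prod_int sub[OF i] by (auto intro: integrable_subinterval_real simp: absolutely_integrable_on_def)
      have "P i - P (i - 1) \<le> grid_size m P"
        unfolding grid_size_def using i by (intro Max_ge) auto
      then have near: "dist (\<phi> p) (\<phi> (d i)) < \<epsilon>" if "p \<in> ?C" for p
      proof -
        have "P (i - 1) \<le> d i" "d i < P i" using d i by auto
        moreover have "P i - P (i - 1) < \<delta>" using \<open>P i - P (i - 1) \<le> grid_size m P\<close> grid \<delta> by simp
        moreover have "a \<le> P (i - 1)" "P i \<le> b" using sub[OF i] calculation by auto
        ultimately show ?thesis using that by (intro unif) (auto simp: dist_real_def)
      qed
      have "integral ?C (\<lambda>p. \<phi> p * \<psi> p) - \<phi> (d i) * cell_weight \<psi> P i = integral ?C (\<lambda>p. \<phi> p * \<psi> p - \<phi> (d i) * \<psi> p)"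
        using int weight[OF i] by (simp add: integral_diff integrable_on_mult_right)
      also have "norm \<dots> \<le> integral ?C (\<lambda>p. \<epsilon> * \<psi> p)"
      proof (rule integral_norm_bound_integral)
        show "(\<lambda>p. \<phi> p * \<psi> p - \<phi> (d i) * \<psi> p) integrable_on ?C" "(\<lambda>p. \<epsilon> * \<psi> p) integrable_on ?C"
          using int by (auto intro!: integrable_diff integrable_on_mult_right)
        fix p assume p: "p \<in> ?C"
        have "norm (\<phi> p * \<psi> p - \<phi> (d i) * \<psi> p) = dist (\<phi> p) (\<phi> (d i)) * \<psi> p"
          using \<psi>_nonneg[of p] p sub[OF i] by (auto simp: dist_real_def abs_mult left_diff_distrib[symmetric])
        also have "\<dots> \<le> \<epsilon> * \<psi> p"
          using near[OF p] \<psi>_nonneg[of p] p sub[OF i] by (intro mult_right_mono) auto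
        finally show "norm (\<phi> p * \<psi> p - \<phi> (d i) * \<psi> p) \<le> \<epsilon> * \<psi> p" .
      qed
      finally show ?thesis using weight[OF i] by simp
    qed
    have "(LINT p:{a..b}|lebesgue. \<phi> p * \<psi> p) = (\<Sum>i = 1..m. integral {P (i - 1)..P i} (\<lambda>p. \<phi> p * \<psi> p))"
      using set_lebesgue_integral_eq_integral[OF prod_int] integral_partition[OF P] by simp
    then have "\<bar>(LINT p:{a..b}|lebesgue. \<phi> p * \<psi> p) - (\<Sum>i = 1..m. \<phi> (d i) * cell_weight \<psi> P i)\<bar> \<le>
        (\<Sum>i = 1..m. \<bar>integral {P (i - 1)..P i} (\<lambda>p. \<phi> p * \<psi> p) - \<phi> (d i) * cell_weight \<psi> P i\<bar>)"
      by (simp add: sum_subtractf[symmetric] sum_abs)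
    also have "\<dots> \<le> (\<Sum>i = 1..m. \<epsilon> * cell_weight \<psi> P i)"
      by (rule sum_mono) (rule cell)
    also have "\<dots> = \<epsilon>"
      using sum_cell_weight[OF pdf P] by (simp add: sum_distrib_left[symmetric])
    finally show ?thesis .
  qed
  \<comment> \<open>Halved, since uniform continuity asks for distances strictly below \<open>\<delta>\<close>.\<close>
  then show ?thesis using \<delta> by (intro exI[of _ "\<delta> / 2"]) auto
qed

theorem theorem4:
  fixes f :: "real^'n \<Rightarrow> real^'k \<Rightarrow> real \<Rightarrow> real^'n"
    and h :: "real^'n \<Rightarrow> real"
    and U :: "(real^'k) set"
    and x0 :: "real^'n"
    and tf p\<^sub>l p\<^sub>u \<mu> \<sigma> \<epsilon> :: real
    and \<psi> :: "real \<Rightarrow> real"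
    and u :: "real \<Rightarrow> real^'k"
  assumes U: "compact U" "convex U"
    and tf: "0 < tf"
    and interval: "p\<^sub>l < p\<^sub>u"
    and \<sigma>: "0 \<le> \<sigma>"
    and f_C1: "C1_on (\<lambda>(x, v, p). f x v p) (UNIV \<times> U \<times> UNIV)"
    and h_C1: "C1_on h UNIV"
    and growth: "\<forall>p. \<exists>L>0. \<exists>C>0. \<forall>x. \<forall>v\<in>U. norm (f x v p) \<le> L * norm x + C"
    and pdf: "is_pdf_on p\<^sub>l p\<^sub>u \<psi>"
    and mean: "(LINT p:{p\<^sub>l..p\<^sub>u}|lebesgue. p * \<psi> p) = \<mu>"
    and second_moment: "(LINT p:{p\<^sub>l..p\<^sub>u}|lebesgue. p^2 * \<psi> p) = \<mu>^2 + \<sigma>^2"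
    and u: "u \<in> admissible_controls tf U"
    and \<epsilon>: "0 < \<epsilon>"
  defines "dF \<equiv> interval_measure (distribution_function p\<^sub>l p\<^sub>u \<psi>)"
  shows "\<exists>\<delta>>0. \<forall>m P d.
    is_partition p\<^sub>l p\<^sub>u m P \<and> (\<forall>i\<in>{1..m}. P (i - 1) \<le> d i \<and> d i < P i) \<and> grid_size m P \<le> \<delta> \<longrightarrow>
      (let q = cell_weight \<psi> P in
        \<bar>(LINT p:{p\<^sub>l..p\<^sub>u}|dF. p) - (\<Sum>i=1..m. d i * q i)\<bar>
          = \<bar>(LINT p:{p\<^sub>l..p\<^sub>u}|lebesgue. p * \<psi> p) - (\<Sum>i=1..m. d i * q i)\<bar> \<and>
        \<bar>(LINT p:{p\<^sub>l..p\<^sub>u}|lebesgue. p * \<psi> p) - (\<Sum>i=1..m. d i * q i)\<bar> \<le> \<epsilon> \<and>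
        \<bar>(LINT p:{p\<^sub>l..p\<^sub>u}|dF. p^2) - (\<Sum>i=1..m. (d i)^2 * q i)\<bar>
          = \<bar>(LINT p:{p\<^sub>l..p\<^sub>u}|lebesgue. p^2 * \<psi> p) - (\<Sum>i=1..m. (d i)^2 * q i)\<bar> \<and>
        \<bar>(LINT p:{p\<^sub>l..p\<^sub>u}|lebesgue. p^2 * \<psi> p) - (\<Sum>i=1..m. (d i)^2 * q i)\<bar> \<le> \<epsilon> \<and>
        \<bar>(LINT p:{p\<^sub>l..p\<^sub>u}|dF. h (solution f tf x0 u p tf))
            - (\<Sum>i=1..m. q i * h (solution f tf x0 u (d i) tf))\<bar> \<le> \<epsilon>)"
proof -
  interpret control_system f U u tf x0
    using U tf f_C1 growth u by unfold_locales auto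
  have h_cont: "continuous_on S (\<lambda>p. h (solution f tf x0 u p tf))" for S
    using continuous_on_compose2[OF C1_on_imp_continuous_on[OF h_C1] solution_continuous_in_parameter] tf by simp
  note to_lebesgue = integral_distribution_function[OF pdf]
  obtain \<delta>1 where \<delta>1: "\<delta>1 > 0" "\<forall>m P d. is_partition p\<^sub>l p\<^sub>u m P \<and> (\<forall>i\<in>{1..m}. P (i - 1) \<le> d i \<and> d i < P i) \<and>
      grid_size m P \<le> \<delta>1 \<longrightarrow>
      \<bar>(LINT p:{p\<^sub>l..p\<^sub>u}|lebesgue. p * \<psi> p) - (\<Sum>i = 1..m. d i * cell_weight \<psi> P i)\<bar> \<le> \<epsilon>"
    using weighted_Riemann_sum_approximation[OF pdf continuous_on_id \<epsilon>] by blast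
  obtain \<delta>2 where \<delta>2: "\<delta>2 > 0" "\<forall>m P d. is_partition p\<^sub>l p\<^sub>u m P \<and> (\<forall>i\<in>{1..m}. P (i - 1) \<le> d i \<and> d i < P i) \<and>
      grid_size m P \<le> \<delta>2 \<longrightarrow>
      \<bar>(LINT p:{p\<^sub>l..p\<^sub>u}|lebesgue. p^2 * \<psi> p) - (\<Sum>i = 1..m. (d i)^2 * cell_weight \<psi> P i)\<bar> \<le> \<epsilon>"
    using weighted_Riemann_sum_approximation[OF pdf continuous_on_power[OF continuous_on_id] \<epsilon>] by blast
  obtain \<delta>3 where \<delta>3: "\<delta>3 > 0" "\<forall>m P d. is_partition p\<^sub>l p\<^sub>u m P \<and> (\<forall>i\<in>{1..m}. P (i - 1) \<le> d i \<and> d i < P i) \<and>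
      grid_size m P \<le> \<delta>3 \<longrightarrow>
      \<bar>(LINT p:{p\<^sub>l..p\<^sub>u}|lebesgue. h (solution f tf x0 u p tf) * \<psi> p) -
        (\<Sum>i = 1..m. h (solution f tf x0 u (d i) tf) * cell_weight \<psi> P i)\<bar> \<le> \<epsilon>"
    using weighted_Riemann_sum_approximation[OF pdf h_cont \<epsilon>] by blast
  have "(LINT p:{p\<^sub>l..p\<^sub>u}|dF. p) = (LINT p:{p\<^sub>l..p\<^sub>u}|lebesgue. p * \<psi> p)"
    "(LINT p:{p\<^sub>l..p\<^sub>u}|dF. p^2) = (LINT p:{p\<^sub>l..p\<^sub>u}|lebesgue. p^2 * \<psi> p)"
    "(LINT p:{p\<^sub>l..p\<^sub>u}|dF. h (solution f tf x0 u p tf)) =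
       (LINT p:{p\<^sub>l..p\<^sub>u}|lebesgue. h (solution f tf x0 u p tf) * \<psi> p)"
    unfolding dF_def by (intro to_lebesgue continuous_intros h_cont)+
  with \<delta>1(2) \<delta>2(2) \<delta>3(2) \<delta>1(1) \<delta>2(1) \<delta>3(1) show ?thesis
    by (intro exI[of _ "min \<delta>1 (min \<delta>2 \<delta>3)"]) (simp add: Let_def mult.commute[of "cell_weight _ _ _"])
qed

end
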